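(* Let $B$ be a transcendence basis of $\mathbb{R}/\mathbb{Q}$ containing $\pi$, let $k=\mathbb{Q}(B\setminus\{\pi\})$, let $H_k=\{b\in\mathbb{R}: b \text{ is algebraic over } k\}$, and let $X_k=\mathbb{R}\setminus H_k$. For all $T,U\in X_k$, $$P_T=P_U\quad\Longleftrightarrow\quad U=aT+b\ \text{ for some } a\in\mathbb{A}_{>0},\ b\in H_k.$$ When such coefficients $a,b$ exist, they are unique.
   Context: $\mathbb{A}=\overline{\mathbb{Q}}\cap\mathbb{R}$ is the field of real algebraic numbers with its usual order, and $\mathbb{A}_{>0}$ is the set of its positive elements. For $T\in X_k$ put $t_T=T^{-1}$, let $\mathcal{O}_T$ be the integral closure in $\mathbb{C}$ of the local ring $k[t_T]_{(t_T)}=\{f(t_T)/g(t_T): f,g\in k[X],\ g(0)\ne0\}$ (the localization of $k[t_T]$ at the maximal ideal $(t_T)$; note $t_T$ is transcendental over $k$), and define $$P_T=\{0\}\cup\bigcup_{n\in\mathbb{Z}}t_T^{-n}(\mathbb{A}_{>0}+t_T\mathcal{O}_T)\subseteq\mathbb{C}.$$ *)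

theory Defs
  imports
    "HOL-Library.Poly_Mapping"
    "HOL-Computational_Algebra.Polynomial"
    "HOL-Analysis.Analysis"
begin

definition is_subfield :: "'a::field set \<Rightarrow> bool" where
  "is_subfield K \<longleftrightarrow> 0 \<in> K \<and> 1 \<in> K \<and>
     (\<forall>x\<in>K. \<forall>y\<in>K. x + y \<in> K \<and> x * y \<in> K) \<and>
     (\<forall>x\<in>K. - x \<in> K \<and> inverse x \<in> K)"

definition field_adjoin :: "'a::field set \<Rightarrow> 'a set \<Rightarrow> 'a set" where
  "field_adjoin F S = is_subfield hull (F \<union> S)"

text \<open>Relative versions of \<^const>\<open>algebraic\<close> and \<^const>\<open>algebraic_int\<close>: the coefficients
  come from a given subset of the ambient ring.\<close>

definition algebraic_over :: "'a::field set \<Rightarrow> 'a \<Rightarrow> bool" where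
  "algebraic_over K x \<longleftrightarrow> (\<exists>p. p \<noteq> 0 \<and> (\<forall>i. coeff p i \<in> K) \<and> poly p x = 0)"

definition integral_closure :: "'a::comm_ring_1 set \<Rightarrow> 'a set" where
  "integral_closure R = {z. \<exists>p. lead_coeff p = 1 \<and> (\<forall>i. coeff p i \<in> R) \<and> poly p z = 0}"

text \<open>A multivariate polynomial is a finitely supported map from monomials to coefficients, a
  monomial being a finitely supported map from variables to exponents. The variables are named by
  the elements of the field themselves, and each variable \<open>x\<close> is evaluated at the element \<open>x\<close>.\<close>

definition mpoly_value :: "(('a \<Rightarrow>\<^sub>0 nat) \<Rightarrow>\<^sub>0 'a) \<Rightarrow> 'a::field" where
  "mpoly_value p = (\<Sum>m\<in>Poly_Mapping.keys p.
     Poly_Mapping.lookup p m * (\<Prod>x\<in>Poly_Mapping.keys m. x ^ Poly_Mapping.lookup m x))"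

definition alg_independent :: "'a::field set \<Rightarrow> 'a set \<Rightarrow> bool" where
  "alg_independent F S \<longleftrightarrow>
     (\<forall>p. (\<forall>m\<in>Poly_Mapping.keys p. Poly_Mapping.lookup p m \<in> F \<and> Poly_Mapping.keys m \<subseteq> S) \<and>
       mpoly_value p = 0 \<longrightarrow> p = 0)"

text \<open>Here the extension field is the whole type.\<close>

definition transcendence_basis :: "'a::field set \<Rightarrow> 'a set \<Rightarrow> bool" where
  "transcendence_basis F B \<longleftrightarrow>
     alg_independent F B \<and> (\<forall>x. algebraic_over (field_adjoin F B) x)"

definition pos_real_algebraic :: "real set" (\<open>\<bbbA>\<^sub>>\<^sub>0\<close>) where
  "\<bbbA>\<^sub>>\<^sub>0 = {a. algebraic a \<and> a > 0}"

definition H_set :: "real set \<Rightarrow> real set" where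
  "H_set k = {b. algebraic_over k b}"

definition X_set :: "real set \<Rightarrow> real set" where
  "X_set k = - H_set k"

text \<open>The local ring \<open>K[t]\<close> localized at \<open>(t)\<close>, as a subring of the ambient field. The
  denominators do not vanish when \<open>t\<close> is transcendental over \<open>K\<close>, which is the only case of
  interest.\<close>

definition local_ring :: "'a::field set \<Rightarrow> 'a \<Rightarrow> 'a set" where
  "local_ring K t = {poly f t / poly g t | f g.
     (\<forall>i. coeff f i \<in> K) \<and> (\<forall>i. coeff g i \<in> K) \<and> poly g 0 \<noteq> 0}"

definition t_param :: "real \<Rightarrow> complex" where
  "t_param T = complex_of_real (inverse T)"

definition O_ring :: "real set \<Rightarrow> real \<Rightarrow> complex set" where
  "O_ring k T = integral_closure (local_ring (complex_of_real ` k) (t_param T))"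

definition P_set :: "real set \<Rightarrow> real \<Rightarrow> complex set" where
  "P_set k T = {0} \<union> (\<Union>n::int. {t_param T powi (- n) * (complex_of_real a + t_param T * z) | a z.
     a \<in> \<bbbA>\<^sub>>\<^sub>0 \<and> z \<in> O_ring k T})"

end

theory Submission
  imports Defs "Jordan_Normal_Form.Char_Poly"
begin

text \<open>Write \<open>t = t\<^sub>T\<close> and \<open>\<O>\<^sub>T\<close> for the integral closure of the local ring of \<open>k[t]\<close> at \<open>t = 0\<close>.

  Every real number algebraic over \<open>k\<close> lies in \<open>\<O>\<^sub>T\<close>, and \<open>t\<close> behaves like a uniformizer: \<open>t\<inverse>\<close>
  is not in \<open>\<O>\<^sub>T\<close>, and \<open>c + t z\<close> is a unit for every constant \<open>c \<noteq> 0\<close> algebraic over \<open>k\<close> and every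
  \<open>z \<in> \<O>\<^sub>T\<close> (\<open>inverse_unit_in_O\<close>). So a nonzero element of \<open>P\<^sub>T\<close> is a power of \<open>t\<close> times a unit
  with positive real algebraic residue, and both the exponent and the residue are well defined.

  If \<open>U = a T + b\<close>, then \<open>t\<^sub>U = t (a + b t)\<inverse>\<close> is \<open>t\<close> times such a unit. Hence
  \<open>\<O>\<^sub>U = \<O>\<^sub>T\<close>, and rewriting powers of \<open>t\<^sub>U\<close> as powers of \<open>t\<close> does not change the sign of the
  residues (\<open>P_set_affine_subset\<close>).

  For the converse, \<open>P\<^sub>T\<close> acts as the positive cone of a partial order on the complex numbers. The
  ideal \<open>t \<O>\<^sub>T\<close> is the set of its infinitesimals (\<open>parameter_ideal_eq_infinitesimals\<close>) and \<open>\<O>\<^sub>T\<close> is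
  the ring of multipliers of that ideal, so \<open>P\<^sub>T\<close> determines both. If \<open>P\<^sub>T = P\<^sub>U\<close>, it follows that
  \<open>U = c T + b\<close> with \<open>c\<close> positive algebraic and \<open>b \<in> \<O>\<^sub>T = \<O>\<^sub>U\<close>. What remains is that \<open>b\<close> is
  algebraic over \<open>k\<close>. A function on a curve without poles is constant; the poles of \<open>b\<close> can only be
  poles of \<open>T\<close> or \<open>U\<close>, and there \<open>b\<close> is regular. The algebraic form of this argument is the
  reciprocity \<open>inverse_in_integral_closure_local_ring\<close>: if \<open>b\<close> is transcendental over \<open>k\<close> and
  \<open>b \<in> \<O>\<^sub>T\<close>, then \<open>T \<in> \<O>\<^sub>b\<close>. It gives \<open>b = U - c T \<in> \<O>\<^sub>b\<close>, while \<open>b = t\<^sub>b\<inverse>\<close> is never in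
  \<open>\<O>\<^sub>b\<close>.

  Uniqueness of the coefficients holds because \<open>T\<close> is not algebraic over \<open>k\<close>.\<close>

section \<open>Subrings and polynomials with restricted coefficients\<close>

definition is_subring :: "'a::comm_ring_1 set \<Rightarrow> bool" where
  "is_subring R \<longleftrightarrow> 0 \<in> R \<and> 1 \<in> R \<and>
     (\<forall>x\<in>R. \<forall>y\<in>R. x + y \<in> R \<and> x * y \<in> R) \<and> (\<forall>x\<in>R. - x \<in> R)"

text \<open>Subrings and subfields vary here inside one ambient field, so polynomials over them are
  polynomials over the ambient field with restricted coefficients.\<close>

definition polys_over :: "'a::zero set \<Rightarrow> 'a poly set" where
  "polys_over R = {p. \<forall>i. coeff p i \<in> R}"

lemma is_subfield_imp_subring: "is_subfield K \<Longrightarrow> is_subring K"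
  by (simp add: is_subfield_def is_subring_def)

lemma polys_overI: "(\<And>i. coeff p i \<in> R) \<Longrightarrow> p \<in> polys_over R"
  and polys_overD: "p \<in> polys_over R \<Longrightarrow> coeff p i \<in> R"
  by (auto simp: polys_over_def)

lemma polys_over_mono: "R \<subseteq> S \<Longrightarrow> polys_over R \<subseteq> polys_over S"
  by (auto simp: polys_over_def)

context
  fixes R :: "'a::comm_ring_1 set"
  assumes R: "is_subring R"
begin

lemma subring_0: "0 \<in> R"
  and subring_1: "1 \<in> R"
  and subring_add: "x \<in> R \<Longrightarrow> y \<in> R \<Longrightarrow> x + y \<in> R"
  and subring_mult: "x \<in> R \<Longrightarrow> y \<in> R \<Longrightarrow> x * y \<in> R"
  and subring_uminus: "x \<in> R \<Longrightarrow> - x \<in> R"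
  using R by (auto simp: is_subring_def)

lemma subring_diff: "x \<in> R \<Longrightarrow> y \<in> R \<Longrightarrow> x - y \<in> R"
  using subring_add[of x "- y"] subring_uminus[of y] by simp

lemma subring_power: "x \<in> R \<Longrightarrow> x ^ n \<in> R"
  by (induction n) (auto intro: subring_1 subring_mult)

lemma subring_sum: "(\<And>i. i \<in> I \<Longrightarrow> f i \<in> R) \<Longrightarrow> sum f I \<in> R"
  by (induction I rule: infinite_finite_induct) (auto intro: subring_0 subring_add)

lemma subring_prod: "(\<And>i. i \<in> I \<Longrightarrow> f i \<in> R) \<Longrightarrow> prod f I \<in> R"
  by (induction I rule: infinite_finite_induct) (auto intro: subring_1 subring_mult)

lemma subring_poly: "p \<in> polys_over R \<Longrightarrow> x \<in> R \<Longrightarrow> poly p x \<in> R"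
  unfolding poly_altdef by (intro subring_sum subring_mult subring_power) (auto dest: polys_overD)

lemma polys_over_subring: "is_subring (polys_over R)"
proof -
  have "p * q \<in> polys_over R" if "p \<in> polys_over R" "q \<in> polys_over R" for p q
    using that unfolding polys_over_def coeff_mult mem_Collect_eq
    by (intro allI subring_sum subring_mult) auto
  then show ?thesis
    unfolding is_subring_def
    by (auto simp: polys_over_def coeff_1 intro: subring_0 subring_1 subring_add subring_uminus)
qed

lemma polys_over_pCons: "c \<in> R \<Longrightarrow> p \<in> polys_over R \<Longrightarrow> pCons c p \<in> polys_over R"
  by (auto simp: polys_over_def coeff_pCons split: nat.split)

lemma polys_over_const: "c \<in> R \<Longrightarrow> [:c:] \<in> polys_over R"
  by (intro polys_over_pCons) (auto simp: polys_over_def subring_0)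

lemma polys_over_X: "[:0, 1:] \<in> polys_over R"
  by (intro polys_over_pCons polys_over_const subring_0 subring_1)

lemma polys_over_reflect: "p \<in> polys_over R \<Longrightarrow> reflect_poly p \<in> polys_over R"
  by (auto simp: polys_over_def coeff_reflect_poly subring_0)

text \<open>The quotient \<open>(p(a) - p(b))/(a - b)\<close> is a polynomial in \<open>a\<close> and \<open>b\<close> with coefficients
  in \<open>R\<close>.\<close>

lemma poly_diff_factor:
  assumes "p \<in> polys_over R" "a \<in> R" "b \<in> R"
  shows "\<exists>h\<in>R. poly p a - poly p b = (a - b) * h"
  using assms(1)
proof (induction p)
  case 0
  then show ?case by (auto intro: bexI[of _ 0] subring_0)
next
  case (pCons c p)
  have p: "p \<in> polys_over R"
    using pCons.prems by (auto simp: polys_over_def) (metis coeff_pCons_Suc)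
  then obtain h where h: "h \<in> R" "poly p a - poly p b = (a - b) * h"
    using pCons.IH by blast
  have "poly (pCons c p) a - poly (pCons c p) b = (a - b) * (poly p a) + b * (poly p a - poly p b)"
    by (simp add: algebra_simps)
  also have "\<dots> = (a - b) * (poly p a + b * h)"
    unfolding h(2) by (simp add: algebra_simps)
  finally show ?case
    using h p assms by (intro bexI[of _ "poly p a + b * h"])
      (auto intro: subring_add subring_mult subring_poly)
qed

end

lemma poly_image_subring:
  assumes R: "is_subring R"
  shows "is_subring ((\<lambda>q. poly q x) ` polys_over R)" (is "is_subring ?S")
proof -
  note P = polys_over_subring[OF R]
  have "y + z \<in> ?S \<and> y * z \<in> ?S \<and> - y \<in> ?S" if yz: "y \<in> ?S" "z \<in> ?S" for y z
  proof -
    obtain p q where "p \<in> polys_over R" "q \<in> polys_over R" "y = poly p x" "z = poly q x"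
      using yz by auto
    then show ?thesis
      by (intro conjI image_eqI[of _ _ "p + q"] image_eqI[of _ _ "p * q"] image_eqI[of _ _ "- p"])
        (simp_all add: subring_add[OF P] subring_mult[OF P] subring_uminus[OF P])
  qed
  moreover have "0 \<in> ?S" "1 \<in> ?S"
    using subring_0[OF P] subring_1[OF P] by (auto intro: image_eqI[of _ _ 0] image_eqI[of _ _ 1])
  ultimately show ?thesis unfolding is_subring_def by simp
qed

section \<open>Integral closures\<close>

lemma integral_closure_iff:
  "z \<in> integral_closure R \<longleftrightarrow> (\<exists>p\<in>polys_over R. lead_coeff p = 1 \<and> poly p z = 0)"
  by (auto simp: integral_closure_def polys_over_def)

lemma algebraic_overI:
  "p \<in> polys_over K \<Longrightarrow> p \<noteq> 0 \<Longrightarrow> poly p x = 0 \<Longrightarrow> algebraic_over K x"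
  by (auto simp: algebraic_over_def polys_over_def)

lemma algebraic_overE:
  assumes "algebraic_over K x"
  obtains p where "p \<in> polys_over K" "p \<noteq> 0" "poly p x = 0"
  using assms by (auto simp: algebraic_over_def polys_over_def)

lemma integral_closureI:
  "p \<in> polys_over R \<Longrightarrow> lead_coeff p = 1 \<Longrightarrow> poly p z = 0 \<Longrightarrow> z \<in> integral_closure R"
  by (auto simp: integral_closure_iff)

lemma integral_closureE:
  assumes "z \<in> integral_closure R"
  obtains p where "p \<in> polys_over R" "lead_coeff p = 1" "poly p z = 0"
  using assms by (auto simp: integral_closure_iff)

lemma integral_closure_mono: "R \<subseteq> S \<Longrightarrow> integral_closure R \<subseteq> integral_closure S"
  unfolding integral_closure_iff subset_iff using polys_over_mono by blast

lemma subset_integral_closure: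
  assumes "is_subring R" shows "R \<subseteq> integral_closure R"
proof
  fix x assume "x \<in> R"
  then show "x \<in> integral_closure R"
    unfolding integral_closure_iff using assms
    by (intro bexI[of _ "[:-x, 1:]"])
      (auto intro!: polys_over_pCons polys_over_const subring_1 subring_uminus)
qed

text \<open>An equation \<open>1 = w q(w)\<close> is a monic equation for \<open>w\<inverse>\<close> read backwards. This form is the
  convenient one, because it says that \<open>w\<close> is a unit of \<open>R[w]\<close>.\<close>

lemma inverse_integral_iff:
  fixes w :: "'a::field"
  assumes R: "is_subring R" and w: "w \<noteq> 0"
  shows "inverse w \<in> integral_closure R \<longleftrightarrow> (\<exists>q\<in>polys_over R. 1 = w * poly q w)"
proof
  assume "inverse w \<in> integral_closure R"
  then obtain p where p: "p \<in> polys_over R" "lead_coeff p = 1" "poly p (inverse w) = 0"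
    by (rule integral_closureE)
  obtain c q where q: "reflect_poly p = pCons c q" by (cases "reflect_poly p")
  have "poly (reflect_poly p) w = 0"
    using poly_reflect_poly_nz[of w p] w p(3) by simp
  moreover have "c = 1" using p(2) q by (metis coeff_0_reflect_poly coeff_pCons_0)
  ultimately have "1 = w * poly (- q) w" by (simp add: q add_eq_0_iff)
  moreover have "q \<in> polys_over R"
    using polys_overD[OF polys_over_reflect[OF R p(1)], of "Suc _"] by (intro polys_overI) (simp add: q)
  ultimately show "\<exists>q\<in>polys_over R. 1 = w * poly q w"
    using subring_uminus[OF polys_over_subring[OF R]] by (intro bexI[of _ "- q"])
next
  assume "\<exists>q\<in>polys_over R. 1 = w * poly q w"
  then obtain q where q: "q \<in> polys_over R" "1 = w * poly q w" by (rule bexE)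
  let ?p = "reflect_poly (pCons 1 (- q))"
  show "inverse w \<in> integral_closure R"
  proof (rule integral_closureI)
    show "?p \<in> polys_over R"
      using q(1) by (intro polys_over_reflect polys_over_pCons subring_1 R
          subring_uminus[OF polys_over_subring])
    show "lead_coeff ?p = 1" by (simp add: degree_reflect_poly_eq coeff_reflect_poly)
    show "poly ?p (inverse w) = 0"
      using poly_reflect_poly_nz[of "inverse w" "pCons 1 (- q)"] w q(2) by simp
  qed
qed

text \<open>Sums, products and iterated integral extensions are all handled through finitely generated
  submodules \<open>M\<close> of the field with \<open>1 \<in> M\<close>. The elements that multiply \<open>M\<close> into itself form a
  ring, all of whose elements turn out to be integral.\<close>

definition is_submodule :: "'a::comm_ring_1 set \<Rightarrow> 'a set \<Rightarrow> bool" where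
  "is_submodule R M \<longleftrightarrow> 0 \<in> M \<and> (\<forall>x\<in>M. \<forall>y\<in>M. x + y \<in> M) \<and> (\<forall>r\<in>R. \<forall>x\<in>M. r * x \<in> M)"

abbreviation R_span :: "'a::comm_ring_1 set \<Rightarrow> 'a set \<Rightarrow> 'a set" where
  "R_span R V \<equiv> is_submodule R hull V"

definition stabilizer :: "'a::comm_ring_1 set \<Rightarrow> 'a set" where
  "stabilizer M = {x. \<forall>m\<in>M. x * m \<in> M}"

lemma is_submodule_R_span: "is_submodule R (R_span R V)"
  by (rule hull_in) (fastforce simp: is_submodule_def)

lemma R_span_0: "0 \<in> R_span R V"
  and R_span_add: "x \<in> R_span R V \<Longrightarrow> y \<in> R_span R V \<Longrightarrow> x + y \<in> R_span R V"
  and R_span_scale: "r \<in> R \<Longrightarrow> x \<in> R_span R V \<Longrightarrow> r * x \<in> R_span R V"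
  using is_submodule_R_span[of R V] by (auto simp: is_submodule_def)

lemma R_span_base: "v \<in> V \<Longrightarrow> v \<in> R_span R V"
  by (rule hull_inc)

lemma R_span_sum: "(\<And>i. i \<in> I \<Longrightarrow> f i \<in> R_span R V) \<Longrightarrow> sum f I \<in> R_span R V"
  by (induction I rule: infinite_finite_induct) (auto intro: R_span_0 R_span_add)

lemma R_span_mult_into:
  assumes "m \<in> R_span R V" and "\<And>v. v \<in> V \<Longrightarrow> x * v \<in> R_span R W"
  shows "x * m \<in> R_span R W"
proof -
  have "R_span R V \<subseteq> {m. x * m \<in> R_span R W}"
  proof (rule hull_minimal)
    show "is_submodule R {m. x * m \<in> R_span R W}"
      by (auto simp: is_submodule_def R_span_0 distrib_left R_span_add mult.left_commute[of x]
          R_span_scale)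
  qed (use assms in auto)
  then show ?thesis using assms(1) by auto
qed

lemma R_span_as_sum:
  assumes R: "is_subring R" and "finite V" and "x \<in> R_span R V"
  shows "\<exists>r. (\<forall>v\<in>V. r v \<in> R) \<and> x = (\<Sum>v\<in>V. r v * v)"
proof -
  let ?M = "{x. \<exists>r. (\<forall>v\<in>V. r v \<in> R) \<and> x = (\<Sum>v\<in>V. r v * v)}"
  have "R_span R V \<subseteq> ?M"
  proof (rule hull_minimal)
    show "V \<subseteq> ?M"
    proof
      fix w assume "w \<in> V"
      then have "w = (\<Sum>v\<in>V. (if v = w then 1 else 0) * v)"
        using \<open>finite V\<close> by (simp add: if_distrib[of "\<lambda>c. c * _"] cong: if_cong)
      then show "w \<in> ?M"
        by (auto intro!: exI[of _ "\<lambda>v. if v = w then 1 else 0"] subring_0[OF R] subring_1[OF R])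
    qed
    show "is_submodule R ?M"
      unfolding is_submodule_def
    proof (intro conjI ballI)
      show "0 \<in> ?M" by (auto intro!: exI[of _ "\<lambda>v. 0"] subring_0[OF R])
    next
      fix x y assume "x \<in> ?M" "y \<in> ?M"
      then obtain r s where "\<forall>v\<in>V. r v \<in> R" "x = (\<Sum>v\<in>V. r v * v)"
        "\<forall>v\<in>V. s v \<in> R" "y = (\<Sum>v\<in>V. s v * v)" by blast
      then show "x + y \<in> ?M"
        by (auto intro!: exI[of _ "\<lambda>v. r v + s v"] subring_add[OF R]
            simp: sum.distrib distrib_right)
    next
      fix c x assume "c \<in> R" "x \<in> ?M"
      then obtain r where "\<forall>v\<in>V. r v \<in> R" "x = (\<Sum>v\<in>V. r v * v)" by blast
      then show "c * x \<in> ?M" using \<open>c \<in> R\<close>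
        by (auto intro!: exI[of _ "\<lambda>v. c * r v"] subring_mult[OF R]
            simp: sum_distrib_left mult.assoc)
    qed
  qed
  then show ?thesis using assms(3) by auto
qed

lemma stabilizer_subring:
  assumes "is_submodule R M" and "1 \<in> R" and "is_subring R"
  shows "is_subring (stabilizer M)"
proof -
  have "- m \<in> M" if "m \<in> M" for m
    using that assms subring_uminus[OF assms(3) assms(2)]
    by (metis is_submodule_def mult_minus1)
  then show ?thesis
    using assms by (auto simp: is_subring_def stabilizer_def is_submodule_def distrib_right mult.assoc)
qed

lemma subset_stabilizer: "is_submodule R M \<Longrightarrow> R \<subseteq> stabilizer M"
  by (auto simp: is_submodule_def stabilizer_def)

lemma char_poly_in_polys_over:
  assumes R: "is_subring R" and A: "A \<in> carrier_mat n n"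
    and entries: "\<And>i j. i < n \<Longrightarrow> j < n \<Longrightarrow> A $$ (i, j) \<in> R"
  shows "char_poly A \<in> polys_over R"
proof -
  note P = polys_over_subring[OF R]
  have "[:- (A $$ (i, j)):] \<in> polys_over R"
    "[:- (A $$ (i, j)), 1:] \<in> polys_over R" if "i < n" "j < n" for i j
    using entries[OF that]
    by (auto intro!: polys_over_pCons[OF R] polys_over_const[OF R] subring_uminus[OF R] subring_1[OF R])
  then have ent: "char_poly_matrix A $$ (i, j) \<in> polys_over R" if "i < n" "j < n" for i j
    using that A by (auto simp: char_poly_matrix_def one_pCons)
  show ?thesis
    unfolding char_poly_def det_def'[OF char_poly_matrix_closed[OF A]]
  proof (intro subring_sum[OF P] subring_mult[OF P] subring_prod[OF P])
    fix p assume "p \<in> {p. p permutes {0..<n}}"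
    then show "char_poly_matrix A $$ (i, p i) \<in> polys_over R" if "i \<in> {0..<n}" for i
      using that permutes_in_image[of p "{0..<n}" i] by (intro ent) auto
    show "signof p \<in> polys_over R"
      using subring_1[OF P] subring_uminus[OF P subring_1[OF P]] by (auto simp: sign_def)
  qed
qed

text \<open>The determinant trick: multiplication by \<open>x\<close> is given on the generators by a matrix with
  entries in \<open>R\<close>. The generators form an eigenvector for the eigenvalue \<open>x\<close>, nonzero because
  they span \<open>1\<close>, so the characteristic polynomial is a monic equation for \<open>x\<close> over \<open>R\<close>.\<close>

lemma stabilizer_imp_integral:
  fixes R :: "'a::field set"
  assumes R: "is_subring R" and V: "finite V" and one: "1 \<in> R_span R V"
    and x: "x \<in> stabilizer (R_span R V)"
  shows "x \<in> integral_closure R"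
proof -
  obtain vs where vs: "set vs = V" "distinct vs"
    using finite_distinct_list[OF V] by blast
  define n where "n = length vs"
  have "\<exists>r. (\<forall>w\<in>V. r w \<in> R) \<and> x * v = (\<Sum>w\<in>V. r w * w)" if "v \<in> V" for v
    using x R_span_base[OF that] by (intro R_span_as_sum[OF R V]) (auto simp: stabilizer_def)
  then obtain r where r: "\<And>v w. v \<in> V \<Longrightarrow> w \<in> V \<Longrightarrow> r v w \<in> R"
    "\<And>v. v \<in> V \<Longrightarrow> x * v = (\<Sum>w\<in>V. r v w * w)"
    by metis
  define A where "A = Matrix.mat n n (\<lambda>(i, j). r (vs ! i) (vs ! j))"
  define u where "u = Matrix.vec n (\<lambda>i. vs ! i)"
  have A: "A \<in> carrier_mat n n" by (simp add: A_def)
  have mem: "vs ! i \<in> V" if "i < n" for i using that vs n_def by auto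
  have "A *\<^sub>v u = x \<cdot>\<^sub>v u"
  proof (rule eq_vecI)
    fix i assume "i < dim_vec (x \<cdot>\<^sub>v u)"
    then have i: "i < n" by (simp add: u_def)
    have "(\<Sum>w\<in>V. r (vs ! i) w * w) = (\<Sum>j<n. r (vs ! i) (vs ! j) * vs ! j)"
      using sum.reindex_bij_betw[OF bij_betw_nth[OF vs(2), of "{..<n}" V], of "\<lambda>w. r (vs ! i) w * w"]
      by (simp add: n_def vs)
    then show "vec_index (A *\<^sub>v u) i = vec_index (x \<cdot>\<^sub>v u) i"
      using i r(2)[OF mem[OF i]]
      by (simp add: A_def u_def scalar_prod_def atLeast0LessThan)
  qed (simp add: A_def u_def)
  moreover have "u \<noteq> 0\<^sub>v n"
  proof
    assume "u = 0\<^sub>v n"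
    then have "vs ! i = 0" if "i < n" for i
      using that by (metis index_vec index_zero_vec(1) u_def)
    then have "V \<subseteq> {0}" using vs n_def by (metis in_set_conv_nth singleton_iff subsetI)
    then have "R_span R V \<subseteq> {0}" by (rule hull_minimal) (auto simp: is_submodule_def)
    then show False using one by auto
  qed
  ultimately have "eigenvalue A x"
    using A by (auto simp: eigenvalue_def eigenvector_def u_def intro!: exI[of _ u])
  then have "poly (char_poly A) x = 0" using eigenvalue_root_char_poly[OF A] by simp
  moreover have "lead_coeff (char_poly A) = 1" using degree_monic_char_poly[OF A] by simp
  moreover have "char_poly A \<in> polys_over R"
    by (rule char_poly_in_polys_over[OF R A]) (auto simp: A_def r(1) mem)
  ultimately show ?thesis by (auto simp: integral_closure_iff)
qed

text \<open>Adjoining \<open>1, x, \<dots>, x\<^sup>d\<^sup>-\<^sup>1\<close>, with \<open>d\<close> the degree of a monic equation for \<open>x\<close>, to the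
  generators gives a module stable under \<open>x\<close>. The coefficients of that equation need not lie in \<open>R\<close>:
  it is enough that they stabilize the old module, which is what makes integrality transitive.\<close>

lemma stabilizer_extend:
  fixes R :: "'a::field set"
  assumes R: "is_subring R" and V: "finite V" and one: "1 \<in> R_span R V"
    and x: "x \<in> integral_closure (stabilizer (R_span R V))"
  shows "\<exists>W. finite W \<and> 1 \<in> R_span R W \<and>
    stabilizer (R_span R V) \<subseteq> stabilizer (R_span R W) \<and> x \<in> stabilizer (R_span R W)"
proof -
  obtain p where p: "p \<in> polys_over (stabilizer (R_span R V))" "lead_coeff p = 1" "poly p x = 0"
    using x by (auto simp: integral_closure_iff)
  define d where "d = degree p"
  define W where "W = (\<lambda>(v, j). v * x ^ j) ` (V \<times> {..<d})"
  have "d \<noteq> 0"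
  proof
    assume "d = 0"
    then obtain c where "p = [:c:]" unfolding d_def by (rule degree_eq_zeroE)
    then show False using p by auto
  qed
  have xd: "x ^ d = (\<Sum>j<d. - coeff p j * x ^ j)"
  proof -
    have "0 = (\<Sum>j\<le>d. coeff p j * x ^ j)" using p(3) by (simp add: poly_altdef d_def)
    also have "\<dots> = (\<Sum>j<d. coeff p j * x ^ j) + x ^ d"
      using p(2) by (simp add: lessThan_Suc_atMost[symmetric] d_def)
    finally have "x ^ d = - (\<Sum>j<d. coeff p j * x ^ j)"
      by (metis add.commute eq_neg_iff_add_eq_0)
    then show ?thesis by (simp add: sum_negf)
  qed
  have mW: "m * x ^ j \<in> R_span R W" if "m \<in> R_span R V" "j < d" for m j
    unfolding mult.commute[of m] by (rule R_span_mult_into[OF that(1)])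
      (use that(2) in \<open>auto simp: W_def mult.commute intro!: R_span_base\<close>)
  have stab: "s \<in> stabilizer (R_span R W)" if "s \<in> stabilizer (R_span R V)" for s
    unfolding stabilizer_def
  proof (clarify)
    fix m assume m: "m \<in> R_span R W"
    show "s * m \<in> R_span R W"
    proof (rule R_span_mult_into[OF m])
      fix w assume "w \<in> W"
      then obtain v j where w: "v \<in> V" "j < d" "w = v * x ^ j" by (auto simp: W_def)
      have "s * v \<in> R_span R V" using that R_span_base[OF w(1)] by (auto simp: stabilizer_def)
      then show "s * w \<in> R_span R W" using mW[OF _ w(2)] by (simp add: w mult.assoc[symmetric])
    qed
  qed
  have xs: "x \<in> stabilizer (R_span R W)"
    unfolding stabilizer_def
  proof (clarify)
    fix m assume m: "m \<in> R_span R W"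
    show "x * m \<in> R_span R W"
    proof (rule R_span_mult_into[OF m])
      fix w assume "w \<in> W"
      then obtain v j where w: "v \<in> V" "j < d" "w = v * x ^ j" by (auto simp: W_def)
      have e: "x * w = v * x ^ Suc j" by (simp add: w mult_ac)
      show "x * w \<in> R_span R W"
      proof (cases "Suc j < d")
        case True
        then show ?thesis unfolding e by (intro mW R_span_base w)
      next
        case False
        then have "Suc j = d" using w by simp
        then have "x * w = (\<Sum>j<d. (- coeff p j * v) * x ^ j)"
          unfolding e by (simp add: xd sum_distrib_left mult_ac del: power_Suc)
        moreover have "(- coeff p j * v) * x ^ j \<in> R_span R W" if "j < d" for j
        proof -
          have "- coeff p j \<in> stabilizer (R_span R V)"
            using stabilizer_subring[OF is_submodule_R_span subring_1[OF R] R] polys_overD[OF p(1)]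
            by (rule subring_uminus)
          then have "- coeff p j * v \<in> R_span R V"
            using R_span_base[OF w(1)] by (auto simp: stabilizer_def)
          then show ?thesis using that by (rule mW)
        qed
        ultimately show ?thesis by (metis (no_types, lifting) R_span_sum lessThan_iff)
      qed
    qed
  qed
  have "1 \<in> R_span R W" using mW[OF one, of 0] \<open>d \<noteq> 0\<close> by simp
  then show ?thesis using stab xs V by (intro exI[of _ W]) (auto simp: W_def)
qed

lemma finite_integral_stabilizer:
  fixes R :: "'a::field set"
  assumes R: "is_subring R" and "finite C" and "C \<subseteq> integral_closure R"
  shows "\<exists>V. finite V \<and> 1 \<in> R_span R V \<and> C \<subseteq> stabilizer (R_span R V)"
  using assms(2,3)
proof (induction C rule: finite_induct)
  case empty
  then show ?case by (intro exI[of _ "{1}"]) (auto intro: R_span_base)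
next
  case (insert x C)
  then obtain V where V: "finite V" "1 \<in> R_span R V" "C \<subseteq> stabilizer (R_span R V)" by auto
  have "x \<in> integral_closure (stabilizer (R_span R V))"
    using insert.prems integral_closure_mono[OF subset_stabilizer[OF is_submodule_R_span[of R V]]] by auto
  from stabilizer_extend[OF R V(1,2) this]
  obtain W where "finite W" "1 \<in> R_span R W"
    "stabilizer (R_span R V) \<subseteq> stabilizer (R_span R W)" "x \<in> stabilizer (R_span R W)"
    by (elim exE conjE)
  then show ?case using V(3) by (intro exI[of _ W]) simp
qed

lemma integral_closure_subring:
  fixes R :: "'a::field set"
  assumes R: "is_subring R"
  shows "is_subring (integral_closure R)"
proof -
  have closed: "x + y \<in> integral_closure R \<and> x * y \<in> integral_closure R \<and> - x \<in> integral_closure R"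
    if "x \<in> integral_closure R" "y \<in> integral_closure R" for x y
  proof -
    have fin: "finite {x, y}" and sub: "{x, y} \<subseteq> integral_closure R"
      using that by auto
    from finite_integral_stabilizer[OF R fin sub]
    obtain V where V: "finite V" "1 \<in> R_span R V" "{x, y} \<subseteq> stabilizer (R_span R V)"
      by (elim exE conjE)
    have "is_subring (stabilizer (R_span R V))"
      by (intro stabilizer_subring[OF is_submodule_R_span] subring_1 R)
    then show ?thesis
      using V(3) stabilizer_imp_integral[OF R V(1,2)] by (auto simp: is_subring_def)
  qed
  moreover have "0 \<in> integral_closure R" "1 \<in> integral_closure R"
    using subset_integral_closure[OF R] subring_0[OF R] subring_1[OF R] by auto
  ultimately show ?thesis unfolding is_subring_def by blast
qed

lemma integral_closure_idem:
  fixes R :: "'a::field set"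
  assumes R: "is_subring R"
  shows "integral_closure (integral_closure R) = integral_closure R"
proof
  show "integral_closure (integral_closure R) \<subseteq> integral_closure R"
  proof
    fix x assume "x \<in> integral_closure (integral_closure R)"
    then obtain p where p: "p \<in> polys_over (integral_closure R)" "lead_coeff p = 1" "poly p x = 0"
      by (auto simp: integral_closure_iff)
    have "set (coeffs p) \<subseteq> integral_closure R"
      using p(1) by (auto simp: coeffs_def polys_over_def split: if_splits)
    from finite_integral_stabilizer[OF R finite_set this]
    obtain V where V: "finite V" "1 \<in> R_span R V" "set (coeffs p) \<subseteq> stabilizer (R_span R V)"
      by (elim exE conjE)
    have "0 \<in> stabilizer (R_span R V)" by (auto simp: stabilizer_def R_span_0)
    then have "p \<in> polys_over (stabilizer (R_span R V))"
      using V(3) by (intro polys_overI) (metis coeff_in_coeffs subsetD le_degree coeff_0)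
    then have "x \<in> integral_closure (stabilizer (R_span R V))"
      using p(2,3) by (rule integral_closureI)
    from stabilizer_extend[OF R V(1,2) this]
    obtain W where "finite W" "1 \<in> R_span R W" "x \<in> stabilizer (R_span R W)"
      by (elim exE conjE)
    then show "x \<in> integral_closure R"
      by (rule stabilizer_imp_integral[OF R])
  qed
qed (rule subset_integral_closure[OF integral_closure_subring[OF R]])

lemma algebraic_over_iff_integral:
  assumes K: "is_subfield K"
  shows "algebraic_over K x \<longleftrightarrow> x \<in> integral_closure K"
proof
  assume "algebraic_over K x"
  then obtain p where p: "p \<in> polys_over K" "p \<noteq> 0" "poly p x = 0"
    by (rule algebraic_overE)
  show "x \<in> integral_closure K"
  proof (rule integral_closureI)
    show "Polynomial.smult (inverse (lead_coeff p)) p \<in> polys_over K"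
      using p K by (auto simp: polys_over_def is_subfield_def)
  qed (use p in auto)
next
  assume "x \<in> integral_closure K"
  then obtain p where p: "p \<in> polys_over K" "lead_coeff p = 1" "poly p x = 0"
    by (rule integral_closureE)
  from p(1) _ p(3) show "algebraic_over K x"
    by (rule algebraic_overI) (use p(2) in auto)
qed

lemma integral_closure_subfield:
  assumes K: "is_subfield (K :: 'a::field set)"
  shows "is_subfield (integral_closure K)"
proof -
  have "inverse x \<in> integral_closure K" if x: "x \<in> integral_closure K" for x
  proof (cases "x = 0")
    case False
    obtain p where p: "p \<in> polys_over K" "p \<noteq> 0" "poly p x = 0"
      using algebraic_over_iff_integral[OF K, THEN iffD2, OF x] by (rule algebraic_overE)
    have refl: "reflect_poly p \<in> polys_over K"
      by (rule polys_over_reflect[OF is_subfield_imp_subring[OF K] p(1)])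
    have root: "poly (reflect_poly p) (inverse x) = 0"
      using poly_reflect_poly_nz[of "inverse x" p] False p(3) by simp
    have "reflect_poly p \<noteq> 0"
      using p(2) by simp
    from algebraic_overI[OF refl this root]
    have "algebraic_over K (inverse x)" .
    then show ?thesis by (rule algebraic_over_iff_integral[OF K, THEN iffD1])
  next
    case True
    then show ?thesis using x by (metis inverse_zero)
  qed
  then show ?thesis
    using integral_closure_subring[OF is_subfield_imp_subring[OF K]]
    unfolding is_subfield_def is_subring_def by (intro conjI ballI) blast+
qed

section \<open>The integral closure of a rational local ring\<close>

locale transcendental_element =
  fixes K :: "'a::field set" and t :: 'a
  assumes K: "is_subfield K" and t: "\<not> algebraic_over K t"
begin

abbreviation R :: "'a set" where "R \<equiv> local_ring K t"
abbreviation \<O> :: "'a set" where "\<O> \<equiv> integral_closure R"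

lemmas K_subring = is_subfield_imp_subring[OF K]
lemmas PK = polys_over_subring[OF K_subring]

lemma in_R_iff: "x \<in> R \<longleftrightarrow>
    (\<exists>f\<in>polys_over K. \<exists>g\<in>polys_over K. poly g 0 \<noteq> 0 \<and> x = poly f t / poly g t)"
  by (auto simp: local_ring_def polys_over_def)

lemma denominator_neq_0:
  assumes "g \<in> polys_over K" "poly g 0 \<noteq> 0"
  shows "poly g t \<noteq> 0"
proof
  assume "poly g t = 0"
  moreover have "g \<noteq> 0" using assms(2) by auto
  ultimately show False using t algebraic_overI[OF assms(1)] by simp
qed

lemma R_fractionI:
  "f \<in> polys_over K \<Longrightarrow> g \<in> polys_over K \<Longrightarrow> poly g 0 \<noteq> 0 \<Longrightarrow> x = poly f t / poly g t \<Longrightarrow> x \<in> R"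
  by (auto simp: in_R_iff)

lemma R_fractionE:
  assumes "x \<in> R"
  obtains f g where "f \<in> polys_over K" "g \<in> polys_over K" "poly g 0 \<noteq> 0" "poly g t \<noteq> 0"
    "x = poly f t / poly g t"
  using assms denominator_neq_0 by (auto simp: in_R_iff)

lemma t_neq_0: "t \<noteq> 0"
proof
  assume "t = 0"
  then have "poly [:0, 1:] t = 0" by simp
  from algebraic_overI[OF polys_over_X[OF K_subring] _ this] t show False by simp
qed

lemma R_subring: "is_subring R"
proof -
  have add_mult: "x + y \<in> R \<and> x * y \<in> R" if xy: "x \<in> R" "y \<in> R" for x y
  proof -
    obtain f g where f: "f \<in> polys_over K" "g \<in> polys_over K" "poly g 0 \<noteq> 0" "poly g t \<noteq> 0"
      "x = poly f t / poly g t" using xy(1) by (rule R_fractionE)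
    obtain f' g' where f': "f' \<in> polys_over K" "g' \<in> polys_over K" "poly g' 0 \<noteq> 0" "poly g' t \<noteq> 0"
      "y = poly f' t / poly g' t" using xy(2) by (rule R_fractionE)
    have eqs: "x + y = poly (f * g' + f' * g) t / poly (g * g') t"
      "x * y = poly (f * f') t / poly (g * g') t"
      using f(4) f'(4) by (simp_all add: f(5) f'(5) add_frac_eq)
    have "poly (g * g') 0 \<noteq> 0" using f f' by simp
    then show ?thesis
      using f f' by (intro conjI R_fractionI[OF _ _ _ eqs(1)] R_fractionI[OF _ _ _ eqs(2)]
          subring_mult[OF PK] subring_add[OF PK])
  qed
  have "- x \<in> R" if x: "x \<in> R" for x
  proof -
    obtain f g where f: "f \<in> polys_over K" "g \<in> polys_over K" "poly g 0 \<noteq> 0" "poly g t \<noteq> 0"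
      "x = poly f t / poly g t" using x by (rule R_fractionE)
    then have "- x = poly (- f) t / poly g t" by simp
    then show ?thesis using f by (intro R_fractionI[of "- f" g] subring_uminus[OF PK])
  qed
  moreover have "0 \<in> R" "1 \<in> R"
    by (rule R_fractionI[of 0 1] R_fractionI[of 1 1]; simp add: subring_0[OF PK] subring_1[OF PK])+
  ultimately show ?thesis using add_mult unfolding is_subring_def by simp
qed

lemma poly_in_R: "f \<in> polys_over K \<Longrightarrow> poly f t \<in> R"
  by (rule R_fractionI[of f 1]) (auto intro: subring_1[OF PK])

lemma K_subset_R: "K \<subseteq> R"
proof
  fix c assume "c \<in> K"
  then have "poly [:c:] t \<in> R" by (intro poly_in_R polys_over_const[OF K_subring])
  then show "c \<in> R" by simp
qed

lemma t_in_R: "t \<in> R"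
  using poly_in_R[OF polys_over_X[OF K_subring]] by simp

text \<open>\<open>R\<close> is local and \<open>t\<close> lies in its maximal ideal: with \<open>r = f(t)/g(t)\<close>, the numerator
  \<open>c g + t f\<close> of \<open>c + t r\<close> still has a nonzero constant term and may serve as a denominator.\<close>

lemma R_unit:
  assumes "c \<in> K" "c \<noteq> 0" "r \<in> R"
  shows "c + t * r \<noteq> 0" "inverse (c + t * r) \<in> R"
proof -
  obtain f g where f: "f \<in> polys_over K" "g \<in> polys_over K" "poly g 0 \<noteq> 0" "poly g t \<noteq> 0"
    "r = poly f t / poly g t" using assms(3) by (rule R_fractionE)
  define h where "h = [:c:] * g + [:0, 1:] * f"
  have h: "h \<in> polys_over K" unfolding h_def
    using f assms(1) by (intro subring_add[OF PK] subring_mult[OF PK] polys_over_X polys_over_const K_subring)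
  have h0: "poly h 0 \<noteq> 0" using f assms by (simp add: h_def)
  have ht: "poly h t \<noteq> 0" by (rule denominator_neq_0[OF h h0])
  have e: "c + t * r = poly h t / poly g t"
    using f by (simp add: h_def field_simps)
  show "c + t * r \<noteq> 0" unfolding e using ht f by simp
  have "inverse (c + t * r) = poly g t / poly h t" unfolding e by simp
  then show "inverse (c + t * r) \<in> R" using h h0 f by (intro R_fractionI)
qed

lemmas O_subring = integral_closure_subring[OF R_subring]
lemmas R_subset_O = subset_integral_closure[OF R_subring]

lemma t_in_O: "t \<in> \<O>"
  using t_in_R R_subset_O by blast

lemma integral_closure_K_subset_O: "integral_closure K \<subseteq> \<O>"
  by (rule integral_closure_mono[OF K_subset_R])

text \<open>Otherwise \<open>t\<close> would be a unit of \<open>R[t] = R\<close>.\<close>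

lemma inverse_t_notin_O: "inverse t \<notin> \<O>"
proof
  assume "inverse t \<in> \<O>"
  then obtain q where q: "q \<in> polys_over R" "1 = t * poly q t"
    unfolding inverse_integral_iff[OF R_subring t_neq_0] by (rule bexE)
  have "- poly q t \<in> R"
    by (intro subring_uminus subring_poly[OF R_subring] R_subring t_in_R q)
  from R_unit(1)[OF subring_1[OF K_subring] _ this] q(2) show False by simp
qed

text \<open>The ring \<open>\<O>\<close> has many maximal ideals in general, but \<open>t\<close> lies in all of them. Concretely, let
  \<open>p\<close> be a monic equation for \<open>z\<close> of degree \<open>n\<close>. Then \<open>t z\<close> is a root of
  \<open>P(X) = t\<^sup>n p(X/t)\<close>, whose value at \<open>-1\<close> is congruent to \<open>(-1)\<^sup>n\<close> modulo \<open>t R\<close> and hence a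
  unit of \<open>R\<close>. As \<open>1 + t z\<close> divides \<open>P(t z) - P(-1) = - P(-1)\<close>, it is a unit too.\<close>

lemma inverse_one_plus_in_O:
  assumes z: "z \<in> \<O>"
  shows "1 + t * z \<noteq> 0" "inverse (1 + t * z) \<in> \<O>"
proof -
  obtain p where p: "p \<in> polys_over R" "lead_coeff p = 1" "poly p z = 0"
    using z by (rule integral_closureE)
  define n where "n = degree p"
  define P where "P = (\<Sum>i\<le>n. monom (coeff p i * t ^ (n - i)) i)"
  have P: "P \<in> polys_over R"
    unfolding P_def by (intro subring_sum[OF polys_over_subring[OF R_subring]] polys_overI)
      (auto intro!: subring_mult[OF R_subring] subring_power[OF R_subring] subring_0[OF R_subring]
        t_in_R polys_overD[OF p(1)])
  have eval: "poly P (t * x) = t ^ n * poly p x" for x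
  proof -
    have "coeff p i * t ^ (n - i) * (t * x) ^ i = t ^ n * (coeff p i * x ^ i)" if "i \<le> n" for i
    proof -
      have "t ^ n = t ^ (n - i) * t ^ i" using that by (simp flip: power_add)
      then show ?thesis by (simp add: power_mult_distrib)
    qed
    then have "(\<Sum>i\<le>n. coeff p i * t ^ (n - i) * (t * x) ^ i) = (\<Sum>i\<le>n. t ^ n * (coeff p i * x ^ i))"
      by (intro sum.cong refl) simp
    then show ?thesis
      by (simp add: P_def poly_sum poly_monom poly_altdef[of p] sum_distrib_left flip: n_def)
  qed
  define r where "r = (\<Sum>i<n. coeff p i * t ^ (n - Suc i) * (- 1) ^ i)"
  have r: "r \<in> R"
    unfolding r_def
    by (intro subring_sum subring_mult subring_power subring_uminus subring_1 R_subring
        t_in_R polys_overD[OF p(1)])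
  have "coeff p i * t ^ (n - i) * (- 1) ^ i = t * (coeff p i * t ^ (n - Suc i) * (- 1) ^ i)"
    if "i < n" for i
    using that by (simp add: Suc_diff_Suc[symmetric])
  then have "(\<Sum>i<n. coeff p i * t ^ (n - i) * (- 1) ^ i) = t * r"
    unfolding r_def sum_distrib_left by (intro sum.cong refl) simp
  then have P1: "poly P (- 1) = (- 1) ^ n + t * r"
    using p(2) by (simp add: P_def poly_sum poly_monom lessThan_Suc_atMost[symmetric] flip: n_def)
  note unit = R_unit[OF _ _ r, of "(- 1) ^ n", folded P1]
  have "(- 1) ^ n \<in> K"
    by (intro subring_power subring_uminus subring_1 K_subring)
  then have nz: "poly P (- 1) \<noteq> 0" and inv: "inverse (poly P (- 1)) \<in> R"
    using unit by simp_all
  have "P \<in> polys_over \<O>" using P polys_over_mono[OF R_subset_O] by blast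
  moreover have "t * z \<in> \<O>" by (rule subring_mult[OF O_subring t_in_O z])
  moreover have "- 1 \<in> \<O>" by (intro subring_uminus subring_1 O_subring)
  ultimately obtain h where h: "h \<in> \<O>" "poly P (t * z) - poly P (- 1) = (t * z - (- 1)) * h"
    using poly_diff_factor[OF O_subring] by blast
  then have "(t * z - (- 1)) * h = - poly P (- 1)"
    using eval[of z] p(3) by simp
  moreover have "(1 + t * z) * (- h) = - ((t * z - (- 1)) * h)" by (simp add: algebra_simps)
  ultimately have eq: "(1 + t * z) * (- h) = poly P (- 1)" by simp
  then show ne: "1 + t * z \<noteq> 0" using nz by auto
  have "inverse (1 + t * z) = - h * inverse (poly P (- 1))"
    using ne nz by (simp add: eq[symmetric])
  then show "inverse (1 + t * z) \<in> \<O>"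
    using h(1) inv R_subset_O by (auto intro!: subring_mult[OF O_subring] subring_uminus[OF O_subring])
qed

lemma inverse_unit_in_O:
  assumes c: "c \<in> integral_closure K" "c \<noteq> 0" and z: "z \<in> \<O>"
  shows "c + t * z \<noteq> 0" "inverse (c + t * z) \<in> \<O>"
proof -
  have ic: "inverse c \<in> \<O>"
    using c(1) integral_closure_subfield[OF K] integral_closure_K_subset_O
    by (auto simp: is_subfield_def)
  then have z': "inverse c * z \<in> \<O>" by (intro subring_mult[OF O_subring] z)
  have eq: "c + t * z = c * (1 + t * (inverse c * z))" using c(2) by (simp add: field_simps)
  show "c + t * z \<noteq> 0" unfolding eq using inverse_one_plus_in_O(1)[OF z'] c(2) by simp
  show "inverse (c + t * z) \<in> \<O>" unfolding eq inverse_mult_distrib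
    by (intro subring_mult[OF O_subring] ic inverse_one_plus_in_O(2)[OF z'])
qed

text \<open>A nonzero element algebraic over \<open>K\<close> is a unit of \<open>\<O>\<close>, whereas no unit is
  a multiple of \<open>t\<close>. Hence an element of \<open>c + t \<O>\<close>, with such a \<open>c\<close> or \<open>c = 0\<close>, determines \<open>c\<close>.\<close>

lemma integral_closure_K_Int_tO:
  assumes "c \<in> integral_closure K" "z \<in> \<O>" "c = t * z"
  shows "c = 0"
proof (rule ccontr)
  assume "c \<noteq> 0"
  then have "inverse c \<in> \<O>"
    using inverse_unit_in_O(2)[OF assms(1) _ subring_0[OF O_subring]] by simp
  then have "z * inverse c \<in> \<O>" by (intro subring_mult[OF O_subring] assms)
  moreover have "z * inverse c = inverse t" using \<open>c \<noteq> 0\<close> assms(3) by (simp add: field_simps)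
  ultimately show False using inverse_t_notin_O by simp
qed

end

text \<open>If \<open>u \<in> t \<O>\<^sub>t\<close>, a polynomial in \<open>u\<close> with nonzero constant term is a nonzero constant plus
  a multiple of \<open>t\<close>, hence a unit of \<open>\<O>\<^sub>t\<close>. So \<open>\<O>\<^sub>t\<close> contains the local ring at \<open>u\<close>, and being
  integrally closed it contains \<open>\<O>\<^sub>u\<close>.\<close>

lemma integral_closure_local_ring_mono:
  assumes t: "transcendental_element K t" and u: "transcendental_element K u"
    and z: "z \<in> integral_closure (local_ring K t)" "u = t * z"
  shows "integral_closure (local_ring K u) \<subseteq> integral_closure (local_ring K t)"
proof -
  interpret t: transcendental_element K t by (rule t)
  interpret u: transcendental_element K u by (rule u)
  have uO: "u \<in> t.\<O>" unfolding z(2) by (rule subring_mult[OF t.O_subring t.t_in_O z(1)])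
  have sub: "polys_over K \<subseteq> polys_over t.\<O>"
    using t.K_subset_R t.R_subset_O by (intro polys_over_mono) blast
  have "u.R \<subseteq> t.\<O>"
  proof
    fix x assume "x \<in> u.R"
    then obtain f g where f: "f \<in> polys_over K" "g \<in> polys_over K" "poly g 0 \<noteq> 0"
      "x = poly f u / poly g u" by (rule u.R_fractionE)
    have "\<exists>h\<in>t.\<O>. poly g u - poly g 0 = (u - 0) * h"
      using f(2) sub by (intro poly_diff_factor t.O_subring uO subring_0[OF t.O_subring]) blast
    then obtain h where h: "h \<in> t.\<O>" "poly g u - poly g 0 = u * h" by auto
    have "poly g 0 \<in> K" by (rule subring_poly[OF t.K_subring f(2) subring_0[OF t.K_subring]])
    then have "poly g 0 \<in> integral_closure K" using subset_integral_closure[OF t.K_subring] by blast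
    moreover have "poly g u = poly g 0 + t * (z * h)" using h(2) z(2) by (simp add: algebra_simps)
    ultimately have "inverse (poly g u) \<in> t.\<O>"
      using t.inverse_unit_in_O(2)[OF _ f(3) subring_mult[OF t.O_subring z(1) h(1)]] by simp
    moreover have "poly f u \<in> t.\<O>" using f(1) sub by (intro subring_poly[OF t.O_subring _ uO]) blast
    ultimately show "x \<in> t.\<O>"
      unfolding f(4) divide_inverse by (rule subring_mult[OF t.O_subring, rotated])
  qed
  from integral_closure_mono[OF this] show ?thesis
    by (simp add: integral_closure_idem[OF t.R_subring])
qed

text \<open>In geometric terms: if \<open>z = w\<inverse>\<close> has no pole where \<open>t = 0\<close>, then conversely \<open>t\<inverse>\<close> has
  no pole where \<open>w = 0\<close>. Algebraically, \<open>w\<close> and \<open>t\<close> generate the unit ideal of \<open>K[w, t]\<close>: an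
  integral equation for \<open>w\<inverse>\<close> gives \<open>g(t) \<in> w K[w, t]\<close> with \<open>g(0) \<noteq> 0\<close>. Sorting that relation
  by powers of \<open>t\<close> over the local ring at \<open>w\<close>, the part free of \<open>t\<close> is \<open>g(0)\<close> minus a multiple of
  \<open>w\<close>, which is a unit there; so \<open>t\<close> is a unit over that local ring, that is, \<open>t\<inverse>\<close> is
  integral over it.\<close>

lemma inverse_in_integral_closure_local_ring:
  assumes t: "transcendental_element K t" and w: "transcendental_element K w"
    and z: "inverse w \<in> integral_closure (local_ring K t)"
  shows "inverse t \<in> integral_closure (local_ring K w)"
proof -
  interpret t: transcendental_element K t by (rule t)
  interpret w: transcendental_element K w by (rule w)
  have w0: "w \<noteq> 0" by (rule w.t_neq_0)
  define S where "S = (\<lambda>q. poly q t) ` polys_over w.R"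
  have S: "is_subring S"
    unfolding S_def by (rule poly_image_subring[OF w.R_subring])
  have RS: "w.R \<subseteq> S"
    by (auto simp: S_def intro!: image_eqI[of _ _ "[:_:]"] polys_over_const[OF w.R_subring])
  have KS: "poly f t \<in> S" if "f \<in> polys_over K" for f
    using that polys_over_mono[OF w.K_subset_R] by (auto simp: S_def)
  \<comment> \<open>The localization of \<open>S\<close> at the \<open>g(t)\<close> with \<open>g(0) \<noteq> 0\<close>; it lets the
    denominators of all coefficients in the equation for \<open>w\<inverse>\<close> be cleared at once.\<close>
  define S' where "S' = {x. \<exists>g\<in>polys_over K. poly g 0 \<noteq> 0 \<and> poly g t * x \<in> S}"
  have SS': "S \<subseteq> S'"
    by (auto simp: S'_def intro!: bexI[of _ 1] subring_1[OF t.PK])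
  have S': "is_subring S'"
  proof -
    have "x + y \<in> S' \<and> x * y \<in> S' \<and> - x \<in> S'" if xy: "x \<in> S'" "y \<in> S'" for x y
    proof -
      obtain g where g: "g \<in> polys_over K" "poly g 0 \<noteq> 0" "poly g t * x \<in> S"
        using xy by (auto simp: S'_def)
      obtain h where h: "h \<in> polys_over K" "poly h 0 \<noteq> 0" "poly h t * y \<in> S"
        using xy by (auto simp: S'_def)
      have "poly (g * h) t * (x + y) = poly h t * (poly g t * x) + poly g t * (poly h t * y)"
        "poly (g * h) t * (x * y) = (poly g t * x) * (poly h t * y)"
        "poly g t * - x = - (poly g t * x)"
        by (simp_all add: algebra_simps)
      then have "poly (g * h) t * (x + y) \<in> S" "poly (g * h) t * (x * y) \<in> S" "poly g t * - x \<in> S"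
        using g h KS by (simp_all only: subring_add[OF S] subring_mult[OF S] subring_uminus[OF S])
      moreover have "g * h \<in> polys_over K" "poly (g * h) 0 \<noteq> 0"
        using g h by (simp_all add: subring_mult[OF t.PK])
      ultimately show ?thesis using g(1,2) unfolding S'_def by blast
    qed
    moreover have "0 \<in> S'" "1 \<in> S'" using SS' subring_0[OF S] subring_1[OF S] by auto
    ultimately show ?thesis unfolding is_subring_def by simp
  qed
  have RS': "t.R \<subseteq> S'"
  proof
    fix x assume "x \<in> t.R"
    then obtain f g where "f \<in> polys_over K" "g \<in> polys_over K" "poly g 0 \<noteq> 0" "poly g t \<noteq> 0"
      "x = poly f t / poly g t" by (rule t.R_fractionE)
    then show "x \<in> S'" unfolding S'_def using KS by (auto intro!: bexI[of _ g])
  qed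
  obtain q where q: "q \<in> polys_over t.R" "1 = w * poly q w"
    using z unfolding inverse_integral_iff[OF t.R_subring w0] by (rule bexE)
  have "poly q w \<in> S'"
    using q(1) polys_over_mono[OF RS'] RS SS' w.t_in_R by (intro subring_poly[OF S']) auto
  then obtain g where g: "g \<in> polys_over K" "poly g 0 \<noteq> 0" "poly g t * poly q w \<in> S"
    by (auto simp: S'_def)
  obtain p where p: "p \<in> polys_over w.R" "poly g t * poly q w = poly p t"
    using g(3) by (auto simp: S_def)
  obtain a p' where p': "p = pCons a p'" by (cases p)
  obtain c g' where g': "g = pCons c g'" by (cases g)
  have a: "a \<in> w.R" and "p' \<in> polys_over w.R"
    using polys_overD[OF p(1), of 0] polys_overD[OF p(1), of "Suc _"]
    by (auto simp: p' intro!: polys_overI)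
  then have y: "poly p' t \<in> S" by (simp add: S_def)
  have c: "c \<in> K" "c \<noteq> 0" and "g' \<in> polys_over K"
    using polys_overD[OF g(1), of 0] polys_overD[OF g(1), of "Suc _"] g(2)
    by (auto simp: g' intro!: polys_overI)
  then have y': "poly g' t \<in> S" by (intro KS)
  have "poly g t = w * (poly g t * poly q w)" using q(2) by (simp add: algebra_simps)
  also have "\<dots> = w * (a + t * poly p' t)" by (simp add: p p')
  finally have eq: "c + w * (- a) = t * (w * poly p' t - poly g' t)"
    by (simp add: g' algebra_simps)
  have u: "c + w * (- a) \<noteq> 0" "inverse (c + w * (- a)) \<in> w.R"
    by (intro w.R_unit c subring_uminus[OF w.R_subring] a)+
  have "1 = t * ((w * poly p' t - poly g' t) * inverse (c + w * (- a)))"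
    using u(1) unfolding mult.assoc[symmetric] eq[symmetric] by simp
  moreover have "(w * poly p' t - poly g' t) * inverse (c + w * (- a)) \<in> S"
    using y y' u(2) RS w.t_in_R by (intro subring_mult[OF S] subring_diff[OF S]) auto
  ultimately have "\<exists>q\<in>polys_over w.R. 1 = t * poly q t"
    by (auto simp: S_def)
  then show ?thesis
    unfolding inverse_integral_iff[OF w.R_subring t.t_neq_0] .
qed

section \<open>Real subfields inside the complex numbers\<close>

lemma is_subfield_field_adjoin: "is_subfield (field_adjoin F S)"
  unfolding field_adjoin_def by (rule hull_in) (fastforce simp: is_subfield_def)

lemma Rats_subset_subfield:
  fixes K :: "'a::field_char_0 set"
  assumes "is_subfield K"
  shows "\<rat> \<subseteq> K"
proof -
  note S = is_subfield_imp_subring[OF assms]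
  have nat: "of_nat n \<in> K" for n :: nat
    by (induction n) (auto intro: subring_0[OF S] subring_1[OF S] subring_add[OF S])
  have int: "of_int n \<in> K" for n :: int
  proof (cases n)
    case (nonneg m)
    then show ?thesis using nat[of m] by simp
  next
    case (neg m)
    then show ?thesis using subring_uminus[OF S nat[of "Suc m"]] by simp
  qed
  show ?thesis
  proof
    fix x :: 'a assume "x \<in> \<rat>"
    then obtain a b where "x = of_int a / of_int b" by (elim Rats_cases') auto
    then show "x \<in> K"
      unfolding divide_inverse using assms by (auto intro!: subring_mult[OF S] int simp: is_subfield_def)
  qed
qed

lemma is_subfield_Rats: "is_subfield (\<rat> :: 'a::field_char_0 set)"
  by (auto simp: is_subfield_def)

lemma algebraic_iff_integral: "algebraic (a::real) \<longleftrightarrow> a \<in> integral_closure \<rat>"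
  unfolding algebraic_over_iff_integral[OF is_subfield_Rats, symmetric]
  by (auto simp: algebraic_altdef algebraic_over_def)

lemma pos_real_algebraic_iff: "a \<in> \<bbbA>\<^sub>>\<^sub>0 \<longleftrightarrow> a \<in> integral_closure \<rat> \<and> 0 < a"
  by (simp add: pos_real_algebraic_def algebraic_iff_integral)

lemmas real_algebraic_subfield = integral_closure_subfield[OF is_subfield_Rats, where 'a1 = real]

lemma pos_real_algebraic_mult: "a \<in> \<bbbA>\<^sub>>\<^sub>0 \<Longrightarrow> b \<in> \<bbbA>\<^sub>>\<^sub>0 \<Longrightarrow> a * b \<in> \<bbbA>\<^sub>>\<^sub>0"
  and pos_real_algebraic_inverse: "a \<in> \<bbbA>\<^sub>>\<^sub>0 \<Longrightarrow> inverse a \<in> \<bbbA>\<^sub>>\<^sub>0"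
  using real_algebraic_subfield by (auto simp: pos_real_algebraic_iff is_subfield_def)

lemma is_subfield_of_real_image:
  "is_subfield k \<Longrightarrow> is_subfield (complex_of_real ` k)"
  unfolding is_subfield_def
  by (auto simp: image_iff simp flip: of_real_add of_real_mult of_real_minus of_real_inverse)

lemma algebraic_over_of_real_iff:
  "algebraic_over (complex_of_real ` k) (complex_of_real x) \<longleftrightarrow> algebraic_over k x"
proof
  assume "algebraic_over (complex_of_real ` k) (complex_of_real x)"
  then obtain p where p: "p \<in> polys_over (complex_of_real ` k)" "p \<noteq> 0" "poly p (complex_of_real x) = 0"
    by (rule algebraic_overE)
  define q where "q = map_poly Re p"
  have coeff_q: "coeff p i = complex_of_real (coeff q i)" "coeff q i \<in> k" for i
    using polys_overD[OF p(1), of i] by (auto simp: q_def coeff_map_poly)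
  have "p = map_poly complex_of_real q" by (rule poly_eqI) (simp add: coeff_map_poly coeff_q(1))
  with p(2,3) have "q \<noteq> 0" "poly q x = 0" by auto
  then show "algebraic_over k x" using coeff_q(2) by (intro algebraic_overI[of q] polys_overI)
next
  assume "algebraic_over k x"
  then obtain q where q: "q \<in> polys_over k" "q \<noteq> 0" "poly q x = 0" by (rule algebraic_overE)
  show "algebraic_over (complex_of_real ` k) (complex_of_real x)"
  proof (rule algebraic_overI)
    show "map_poly complex_of_real q \<in> polys_over (complex_of_real ` k)"
      using q(1) by (auto simp: polys_over_def coeff_map_poly)
    show "map_poly complex_of_real q \<noteq> 0" using q(2) by (simp add: map_poly_eq_0_iff)
    show "poly (map_poly complex_of_real q) (complex_of_real x) = 0" using q(3) by simp
  qed
qed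

lemma H_set_iff:
  assumes "is_subfield k"
  shows "b \<in> H_set k \<longleftrightarrow> complex_of_real b \<in> integral_closure (complex_of_real ` k)"
  unfolding algebraic_over_iff_integral[OF is_subfield_of_real_image[OF assms], symmetric]
  by (simp add: H_set_def algebraic_over_of_real_iff)

lemma H_set_subfield:
  assumes "is_subfield k" shows "is_subfield (H_set k)"
  using integral_closure_subfield[OF assms] algebraic_over_iff_integral[OF assms]
  by (simp add: H_set_def)

lemma real_algebraic_subset_H_set:
  assumes "is_subfield k" shows "integral_closure \<rat> \<subseteq> H_set k"
  using integral_closure_mono[OF Rats_subset_subfield[OF assms]] algebraic_over_iff_integral[OF assms]
  by (auto simp: H_set_def)

section \<open>The sets \<open>P\<^sub>T\<close>\<close>

locale point_at_infinity =
  fixes k :: "real set" and T :: real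
  assumes k: "is_subfield k" and T: "T \<in> X_set k"
begin

abbreviation t :: complex where "t \<equiv> t_param T"

sublocale transcendental_element "complex_of_real ` k" t
proof
  show "is_subfield (complex_of_real ` k)" by (rule is_subfield_of_real_image[OF k])
  show "\<not> algebraic_over (complex_of_real ` k) t"
  proof
    assume "algebraic_over (complex_of_real ` k) t"
    then have "inverse T \<in> H_set k"
      by (simp add: H_set_def t_param_def algebraic_over_of_real_iff del: of_real_inverse)
    then have "inverse (inverse T) \<in> H_set k"
      using H_set_subfield[OF k] unfolding is_subfield_def by blast
    then show False using T by (simp add: X_set_def)
  qed
qed

lemma O_ring_eq: "O_ring k T = \<O>"
  by (simp add: O_ring_def)

lemma inverse_t: "inverse t = complex_of_real T"
  by (simp add: t_param_def)

lemma real_algebraic_in: "a \<in> integral_closure \<rat> \<Longrightarrow> complex_of_real a \<in> integral_closure (complex_of_real ` k)"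
  using real_algebraic_subset_H_set[OF k] H_set_iff[OF k] by blast

lemma real_algebraic_in_O: "a \<in> integral_closure \<rat> \<Longrightarrow> complex_of_real a \<in> \<O>"
  using real_algebraic_in integral_closure_K_subset_O by blast

text \<open>The units of \<open>\<O>\<close> whose residue modulo \<open>t\<close> is a positive real algebraic number. They form a group,
  and \<open>P\<^sub>T\<close> consists of \<open>0\<close> and their multiples by powers of \<open>t\<close>.\<close>

definition pos_units :: "complex set" where
  "pos_units = {complex_of_real a + t * z | a z. a \<in> \<bbbA>\<^sub>>\<^sub>0 \<and> z \<in> \<O>}"

lemma pos_unitsI: "a \<in> \<bbbA>\<^sub>>\<^sub>0 \<Longrightarrow> z \<in> \<O> \<Longrightarrow> x = complex_of_real a + t * z \<Longrightarrow> x \<in> pos_units"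
  by (auto simp: pos_units_def)

lemma pos_unitsE:
  assumes "x \<in> pos_units"
  obtains a z where "a \<in> \<bbbA>\<^sub>>\<^sub>0" "z \<in> \<O>" "x = complex_of_real a + t * z"
  using assms by (auto simp: pos_units_def)

lemma pos_units_subset_O: "pos_units \<subseteq> \<O>"
  by (auto simp: pos_units_def pos_real_algebraic_iff intro!: subring_add[OF O_subring]
      subring_mult[OF O_subring] real_algebraic_in_O t_in_O)

lemma pos_units_mult:
  assumes "x \<in> pos_units" "y \<in> pos_units" shows "x * y \<in> pos_units"
proof -
  obtain a z where x: "a \<in> \<bbbA>\<^sub>>\<^sub>0" "z \<in> \<O>" "x = complex_of_real a + t * z" using assms(1) by (rule pos_unitsE)
  obtain b w where y: "b \<in> \<bbbA>\<^sub>>\<^sub>0" "w \<in> \<O>" "y = complex_of_real b + t * w" using assms(2) by (rule pos_unitsE)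
  show ?thesis
  proof (rule pos_unitsI)
    show "a * b \<in> \<bbbA>\<^sub>>\<^sub>0" using x y by (intro pos_real_algebraic_mult)
    show "complex_of_real a * w + z * y \<in> \<O>"
      unfolding y(3) using x y
      by (intro subring_add[OF O_subring] subring_mult[OF O_subring] real_algebraic_in_O t_in_O)
        (simp_all add: pos_real_algebraic_iff)
  qed (simp add: x y algebra_simps)
qed

lemma pos_units_inverse:
  assumes "x \<in> pos_units" shows "x \<noteq> 0" "inverse x \<in> pos_units"
proof -
  obtain a z where x: "a \<in> \<bbbA>\<^sub>>\<^sub>0" "z \<in> \<O>" "x = complex_of_real a + t * z" using assms(1) by (rule pos_unitsE)
  note u = inverse_unit_in_O[OF real_algebraic_in _ x(2), of a, folded x(3)]
  show ne: "x \<noteq> 0" using u(1) x(1) by (simp add: pos_real_algebraic_iff)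
  have inv: "inverse x \<in> \<O>" using u(2) x(1) by (simp add: pos_real_algebraic_iff)
  have a': "inverse a \<in> \<bbbA>\<^sub>>\<^sub>0" by (rule pos_real_algebraic_inverse[OF x(1)])
  have "a \<noteq> 0" using x(1) by (simp add: pos_real_algebraic_iff)
  show "inverse x \<in> pos_units"
  proof (rule pos_unitsI[OF a'])
    show "- (complex_of_real (inverse a) * (z * inverse x)) \<in> \<O>"
      using a' inv x(2) unfolding pos_real_algebraic_iff
      by (intro subring_uminus[OF O_subring] subring_mult[OF O_subring] real_algebraic_in_O) simp_all
    have "complex_of_real a * (x * inverse x) = complex_of_real a" using ne by simp
    have "inverse x = inverse (complex_of_real a) * ((x - t * z) * inverse x)"
      using \<open>a \<noteq> 0\<close> by (simp add: x(3))
    also have "\<dots> = inverse (complex_of_real a) * (1 - t * z * inverse x)"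
      using ne by (simp add: left_diff_distrib)
    finally show "inverse x = complex_of_real (inverse a) + t * - (complex_of_real (inverse a) * (z * inverse x))"
      by (simp add: algebra_simps)
  qed
qed

lemma one_in_pos_units: "1 \<in> pos_units"
  by (rule pos_unitsI[of 1 0]) (auto simp: pos_real_algebraic_def subring_0[OF O_subring])

lemma pos_units_powi: "x \<in> pos_units \<Longrightarrow> x powi m \<in> pos_units"
proof -
  have "y ^ n \<in> pos_units" if "y \<in> pos_units" for y n
    using that by (induction n) (auto intro: one_in_pos_units pos_units_mult)
  then show "x \<in> pos_units \<Longrightarrow> x powi m \<in> pos_units"
    by (auto simp: power_int_def pos_units_inverse)
qed

lemma P_set_iff: "x \<in> P_set k T \<longleftrightarrow> x = 0 \<or> (\<exists>m. \<exists>e\<in>pos_units. x = t powi m * e)"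
proof -
  have "(\<exists>n::int. \<exists>a z. x = t powi - n * (complex_of_real a + t * z) \<and> a \<in> \<bbbA>\<^sub>>\<^sub>0 \<and> z \<in> \<O>) \<longleftrightarrow>
    (\<exists>m. \<exists>a z. x = t powi m * (complex_of_real a + t * z) \<and> a \<in> \<bbbA>\<^sub>>\<^sub>0 \<and> z \<in> \<O>)"
    by (metis minus_minus)
  then show ?thesis
    by (auto simp: P_set_def O_ring_eq pos_units_def)
qed

lemma P_setI: "e \<in> pos_units \<Longrightarrow> x = t powi m * e \<Longrightarrow> x \<in> P_set k T"
  by (auto simp: P_set_iff)

lemma P_setE:
  assumes "x \<in> P_set k T"
  obtains "x = 0"
    | m a z where "a \<in> \<bbbA>\<^sub>>\<^sub>0" "z \<in> \<O>" "x = t powi m * (complex_of_real a + t * z)"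
  using assms by (auto simp: P_set_iff pos_units_def)

lemma pos_units_subset_P_set: "e \<in> pos_units \<Longrightarrow> e \<in> P_set k T"
  by (rule P_setI[of e _ 0]) simp_all

lemma P_set_scale:
  assumes "x \<in> P_set k T" shows "t powi m * x \<in> P_set k T"
  using assms
proof (cases rule: P_setE)
  case (2 m' a z)
  have "t powi m * x = t powi (m + m') * (complex_of_real a + t * z)"
    using t_neq_0 by (simp add: 2 power_int_add)
  then show ?thesis by (rule P_setI[OF pos_unitsI[OF 2(1,2) refl]])
qed (simp add: P_set_iff)

lemma powi_in_tO:
  assumes "0 < m" "z \<in> \<O>"
  shows "\<exists>y\<in>\<O>. t powi m * z = t * y"
proof -
  obtain n where n: "m = int (Suc n)"
    using assms(1) by (auto dest!: zero_less_imp_eq_int gr0_implies_Suc)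
  have "t powi m = t * t ^ n" unfolding n power_int_of_nat by simp
  then show ?thesis
    using assms(2) by (intro bexI[of _ "t ^ n * z"] subring_mult[OF O_subring] subring_power[OF O_subring] t_in_O)
      (simp_all add: mult.assoc)
qed

text \<open>The leading coefficient of an element of \<open>P\<^sub>T\<close> is positive and well defined. So an element of
  \<open>b + t \<O>\<close> in \<open>P\<^sub>T\<close> either has leading coefficient \<open>b\<close>, and \<open>b > 0\<close>, or it lies in \<open>t \<O>\<close>, and
  \<open>b = 0\<close>.\<close>

lemma nonneg_of_P_set:
  assumes b: "b \<in> integral_closure \<rat>" and z: "z \<in> \<O>"
    and x: "complex_of_real b + t * z \<in> P_set k T"
  shows "0 \<le> b"
proof -
  have eq0: "c = 0" if "c \<in> integral_closure \<rat>" "y \<in> \<O>" "complex_of_real c = t * y" for c y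
    using integral_closure_K_Int_tO[OF real_algebraic_in[OF that(1)] that(2,3)] by simp
  from x show ?thesis
  proof (cases rule: P_setE)
    case 1
    then have "complex_of_real b = t * (- z)" by (simp add: add_eq_0_iff2)
    then show ?thesis using eq0[OF b subring_uminus[OF O_subring z]] by simp
  next
    case (2 m a w)
    have a: "a \<in> integral_closure \<rat>" "0 < a" using 2(1) by (simp_all add: pos_real_algebraic_iff)
    have aO: "complex_of_real a + t * w \<in> \<O>" and bO: "complex_of_real b + t * z \<in> \<O>"
      using a b z 2(2) by (auto intro!: subring_add[OF O_subring] subring_mult[OF O_subring]
          real_algebraic_in_O t_in_O)
    consider "m = 0" | "0 < m" | "m < 0" by linarith
    then show ?thesis
    proof cases
      case 1
      have "a - b \<in> integral_closure \<rat>"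
        by (intro subring_diff a b is_subfield_imp_subring real_algebraic_subfield)
      moreover have "complex_of_real (a - b) = t * (z - w)" using 2(3) 1 by (simp add: algebra_simps)
      ultimately show ?thesis using eq0[OF _ subring_diff[OF O_subring z 2(2)]] a(2) by fastforce
    next
      case pos: 2
      obtain y where y: "y \<in> \<O>" "t powi m * (complex_of_real a + t * w) = t * y"
        using powi_in_tO[OF pos aO] by (rule bexE)
      then have "complex_of_real b = t * (y - z)" using 2(3) by (simp add: algebra_simps)
      then show ?thesis using eq0[OF b subring_diff[OF O_subring y(1) z]] by simp
    next
      case neg: 3
      then have "0 < - m" by simp
      from powi_in_tO[OF this bO] obtain y where
        y: "y \<in> \<O>" "t powi (- m) * (complex_of_real b + t * z) = t * y" by (rule bexE)
      have "complex_of_real a + t * w = t powi (- m) * (complex_of_real b + t * z)"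
        unfolding 2(3) using t_neq_0 by (simp add: power_int_minus)
      then have "complex_of_real a = t * (y - w)" using y(2) by (simp add: algebra_simps)
      then show ?thesis using eq0[OF a(1) subring_diff[OF O_subring y(1) 2(2)]] a(2) by simp
    qed
  qed
qed

text \<open>Think of \<open>y - x \<in> P\<^sub>T\<close> as \<open>x < y\<close> (for \<open>x \<noteq> y\<close>). Then \<open>t \<O>\<close> is the set of elements
  infinitesimal with respect to the rationals, so it can be read off from \<open>P\<^sub>T\<close>. The bound for
  \<open>\<epsilon> = 1\<close> excludes poles and leaves \<open>x \<in> b + t \<O>\<close> with \<open>b\<close> real algebraic; the bounds for
  small \<open>\<epsilon>\<close> give \<open>b = 0\<close>.\<close>

lemma parameter_ideal_eq_infinitesimals:
  "(\<lambda>z. t * z) ` \<O> = {x. \<forall>e\<in>\<rat>. 0 < e \<longrightarrow>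
     complex_of_real e + x \<in> P_set k T \<and> complex_of_real e - x \<in> P_set k T}" (is "_ = ?I")
proof (intro Set.set_eqI iffI)
  fix x assume "x \<in> (\<lambda>z. t * z) ` \<O>"
  then obtain z where z: "z \<in> \<O>" "x = t * z" by auto
  have "complex_of_real e + x \<in> P_set k T \<and> complex_of_real e - x \<in> P_set k T" if "e \<in> \<rat>" "0 < e" for e
  proof -
    have e: "e \<in> \<bbbA>\<^sub>>\<^sub>0"
      using that subset_integral_closure[OF is_subfield_imp_subring[OF is_subfield_Rats]]
      by (auto simp: pos_real_algebraic_iff)
    show ?thesis
      by (intro conjI pos_units_subset_P_set pos_unitsI[OF e z(1)] pos_unitsI[OF e subring_uminus[OF O_subring z(1)]])
        (simp_all add: z)
  qed
  then show "x \<in> ?I" by blast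
next
  fix x assume x: "x \<in> ?I"
  note A = is_subfield_imp_subring[OF real_algebraic_subfield]
  have rat: "e \<in> integral_closure \<rat>" if "e \<in> \<rat>" for e :: real
    using that subset_integral_closure[OF is_subfield_imp_subring[OF is_subfield_Rats]] by auto
  have "\<exists>b\<in>integral_closure \<rat>. \<exists>z\<in>\<O>. x = complex_of_real b + t * z"
  proof -
    have wit: ?thesis if "b \<in> integral_closure \<rat>" "z \<in> \<O>" "x = complex_of_real b + t * z" for b z
      using that by blast
    have P1: "1 + x \<in> P_set k T" "1 - x \<in> P_set k T" using x by (force dest: bspec[of _ _ 1])+
    from P1(1) show ?thesis
    proof (cases rule: P_setE)
      case 1
      then have "x = complex_of_real (- 1) + t * 0" by (simp add: add_eq_0_iff)
      then show ?thesis by (rule wit[OF rat subring_0[OF O_subring], rotated]) simp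
    next
      case (2 m a z)
      have a: "a \<in> integral_closure \<rat>" "0 < a" using 2(1) by (simp_all add: pos_real_algebraic_iff)
      have aO: "complex_of_real a + t * z \<in> \<O>"
        using a 2(2) by (auto intro!: subring_add[OF O_subring] subring_mult[OF O_subring]
            real_algebraic_in_O t_in_O)
      consider "m = 0" | "0 < m" | "m < 0" by linarith
      then show ?thesis
      proof cases
        case 1
        then have "x = complex_of_real (a - 1) + t * z" using 2(3) by (simp add: algebra_simps)
        then show ?thesis by (rule wit[OF subring_diff[OF A a(1) rat] 2(2), rotated]) simp
      next
        case pos: 2
        obtain y where y: "y \<in> \<O>" "t powi m * (complex_of_real a + t * z) = t * y"
          using powi_in_tO[OF pos aO] by (rule bexE)
        then have "x = complex_of_real (- 1) + t * y" using 2(3) by (simp add: algebra_simps)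
        then show ?thesis by (rule wit[OF rat y(1), rotated]) simp
      next
        case neg: 3
        then have "0 < - m" by simp
        have "2 \<in> \<O>" using real_algebraic_in_O[OF rat[of 2]] by simp
        from powi_in_tO[OF \<open>0 < - m\<close> this] obtain y where
          y: "y \<in> \<O>" "t powi (- m) * 2 = t * y" by (rule bexE)
        \<comment> \<open>The leading coefficient of \<open>1 - x = 2 - (1 + x)\<close> would be \<open>-a\<close>.\<close>
        have "t powi (- m) * (1 - x) = t powi (- m) * 2 - t powi (- m) * (1 + x)"
          by (simp add: algebra_simps)
        also have "\<dots> = complex_of_real (- a) + t * (y - z)"
          unfolding 2(3) y(2) using t_neq_0 by (simp add: power_int_minus algebra_simps)
        finally have "complex_of_real (- a) + t * (y - z) \<in> P_set k T"
          using P_set_scale[OF P1(2), of "- m"] by simp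
        from nonneg_of_P_set[OF subring_uminus[OF A a(1)] subring_diff[OF O_subring y(1) 2(2)] this]
        show ?thesis using a(2) by simp
      qed
    qed
  qed
  then obtain b z where b: "b \<in> integral_closure \<rat>" "z \<in> \<O>" "x = complex_of_real b + t * z"
    by (elim bexE)
  have "\<bar>b\<bar> \<le> e" if e: "e \<in> \<rat>" "0 < e" for e
  proof -
    have "complex_of_real (e + b) + t * z \<in> P_set k T" "complex_of_real (e - b) + t * (- z) \<in> P_set k T"
      using x e by (auto simp: b(3) algebra_simps)
    then have "0 \<le> e + b" "0 \<le> e - b"
      using nonneg_of_P_set[OF subring_add[OF A rat[OF e(1)] b(1)] b(2)]
        nonneg_of_P_set[OF subring_diff[OF A rat[OF e(1)] b(1)] subring_uminus[OF O_subring b(2)]] by auto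
    then show ?thesis by linarith
  qed
  then have "b = 0" using Rats_dense_in_real[of 0 "\<bar>b\<bar>"] by force
  then show "x \<in> (\<lambda>z. t * z) ` \<O>" using b by auto
qed

text \<open>Since \<open>t \<O>\<close> is a principal ideal with nonzero generator, its ring of multipliers
  is \<open>\<O>\<close> itself; thus \<open>\<O>\<close> is determined by the set \<open>t \<O>\<close>.\<close>

lemma O_eq_multipliers: "\<O> = {x. \<forall>y\<in>(\<lambda>z. t * z) ` \<O>. x * y \<in> (\<lambda>z. t * z) ` \<O>}"
proof (intro Set.set_eqI iffI)
  fix x assume "x \<in> \<O>"
  then show "x \<in> {x. \<forall>y\<in>(\<lambda>z. t * z) ` \<O>. x * y \<in> (\<lambda>z. t * z) ` \<O>}"
    by (auto simp: mult.left_commute[of x] intro!: imageI subring_mult[OF O_subring])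
next
  fix x assume "x \<in> {x. \<forall>y\<in>(\<lambda>z. t * z) ` \<O>. x * y \<in> (\<lambda>z. t * z) ` \<O>}"
  then have "x * (t * 1) \<in> (\<lambda>z. t * z) ` \<O>" using subring_1[OF O_subring] by blast
  then show "x \<in> \<O>" using t_neq_0 by (auto simp: mult.commute)
qed

end

text \<open>The substitution multiplies the parameter by the unit \<open>e = (a + b t)\<inverse>\<close>, whose residue
  \<open>a\<inverse>\<close> is positive, so signs of leading coefficients are preserved. Equality of the two
  sets comes from the same inclusion for the inverse substitution.\<close>

lemma P_set_affine_subset:
  assumes k: "is_subfield k" and T: "T \<in> X_set k" and U: "U \<in> X_set k"
    and a: "a \<in> \<bbbA>\<^sub>>\<^sub>0" and b: "b \<in> H_set k" and eq: "U = a * T + b"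
  shows "P_set k U \<subseteq> P_set k T"
proof -
  interpret T: point_at_infinity k T by unfold_locales (rule k T)+
  interpret U: point_at_infinity k U by unfold_locales (rule k U)+
  have bO: "complex_of_real b \<in> T.\<O>"
    using b T.integral_closure_K_subset_O by (auto simp: H_set_iff[OF k])
  define e where "e = inverse (complex_of_real a + T.t * complex_of_real b)"
  have e: "e \<in> T.pos_units" unfolding e_def by (intro T.pos_units_inverse T.pos_unitsI[OF a bO] refl)
  have "inverse U.t = inverse T.t * inverse e"
  proof -
    have Tt: "complex_of_real T * T.t = 1" using T.t_neq_0 by (simp flip: T.inverse_t)
    have "complex_of_real T * (complex_of_real a + T.t * complex_of_real b) =
        complex_of_real a * complex_of_real T + (complex_of_real T * T.t) * complex_of_real b"
      by (simp add: algebra_simps)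
    also have "\<dots> = complex_of_real U" unfolding Tt by (simp add: eq)
    finally show ?thesis
      unfolding T.inverse_t U.inverse_t by (simp add: e_def)
  qed
  then have u: "U.t = T.t * e" by (metis inverse_inverse_eq inverse_mult_distrib)
  have eO: "e \<in> T.\<O>" using e T.pos_units_subset_O by blast
  have sub: "U.\<O> \<subseteq> T.\<O>"
    by (rule integral_closure_local_ring_mono[OF T.transcendental_element_axioms
          U.transcendental_element_axioms eO u])
  have "y \<in> T.pos_units" if y: "y \<in> U.pos_units" for y
  proof -
    obtain c z where c: "c \<in> \<bbbA>\<^sub>>\<^sub>0" "z \<in> U.\<O>" "y = complex_of_real c + U.t * z"
      using y by (rule U.pos_unitsE)
    show ?thesis
      using c(2) sub by (intro T.pos_unitsI[OF c(1), of "e * z"] subring_mult[OF T.O_subring] eO)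
        (auto simp: c(3) u)
  qed
  moreover have "e powi m \<in> T.pos_units" for m by (rule T.pos_units_powi[OF e])
  ultimately have main: "\<exists>y'\<in>T.pos_units. U.t powi m * y = T.t powi m * y'" if "y \<in> U.pos_units" for y m
    using that by (intro bexI[of _ "e powi m * y"] T.pos_units_mult)
      (simp_all add: u power_int_mult_distrib mult.assoc)
  have "x \<in> P_set k T" if "x \<in> P_set k U" for x
    using that
  proof (cases rule: U.P_setE)
    case (2 m c z)
    obtain y' where "y' \<in> T.pos_units" "x = T.t powi m * y'"
      using main[OF U.pos_unitsI[OF 2(1,2) refl], of m] 2(3) by auto
    then show ?thesis by (rule T.P_setI)
  qed (simp add: T.P_set_iff)
  then show ?thesis by (rule subsetI)
qed

text \<open>By the intrinsic description of \<open>t \<O>\<close>, equality of the sets gives \<open>\<O>\<^sub>T = \<O>\<^sub>U = \<O>\<close> and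
  \<open>t\<^sub>T \<O> = t\<^sub>U \<O>\<close>. As \<open>t\<^sub>U \<in> P\<^sub>T\<close>, the quotient \<open>e = t\<^sub>U/t\<^sub>T\<close> is a unit with positive residue,
  and inverting \<open>t\<^sub>U = e t\<^sub>T\<close> gives \<open>U = c T + b\<close> with \<open>c\<close> positive algebraic and \<open>b \<in> \<O>\<close>
  real. If \<open>b\<close> were transcendental over \<open>k\<close>, then \<open>b \<in> \<O>\<^sub>T\<close> and \<open>b \<in> \<O>\<^sub>U\<close> would say that \<open>b\<close>
  has no pole at the poles of \<open>T\<close> and of \<open>U\<close>; hence \<open>T\<close> and \<open>U\<close> would have no pole at the
  poles of \<open>b\<close>, and \<open>b = U - c T\<close> none either.\<close>

lemma P_set_eq_imp_affine:
  assumes k: "is_subfield k" and T: "T \<in> X_set k" and U: "U \<in> X_set k"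
    and P: "P_set k T = P_set k U"
  shows "\<exists>a\<in>\<bbbA>\<^sub>>\<^sub>0. \<exists>b\<in>H_set k. U = a * T + b"
proof -
  interpret T: point_at_infinity k T by unfold_locales (rule k T)+
  interpret U: point_at_infinity k U by unfold_locales (rule k U)+
  note ring = T.O_subring
  have I: "(\<lambda>z. T.t * z) ` T.\<O> = (\<lambda>z. U.t * z) ` U.\<O>"
    unfolding T.parameter_ideal_eq_infinitesimals U.parameter_ideal_eq_infinitesimals P ..
  have O: "T.\<O> = U.\<O>"
    by (subst T.O_eq_multipliers, subst U.O_eq_multipliers) (simp only: I)
  have "U.t * 1 \<in> (\<lambda>z. T.t * z) ` T.\<O>"
    unfolding I by (intro imageI subring_1[OF U.O_subring])
  then obtain w where w: "w \<in> T.\<O>" "U.t = T.t * w" by auto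
  have "T.t * 1 \<in> (\<lambda>z. U.t * z) ` U.\<O>"
    unfolding I[symmetric] by (intro imageI subring_1[OF T.O_subring])
  then obtain w' where w': "w' \<in> T.\<O>" "T.t = U.t * w'" unfolding O by auto
  have ww': "w * w' = 1" using w(2) w'(2) T.t_neq_0 by (metis mult.assoc mult_cancel_left2)
  have "U.t \<in> P_set k T"
    unfolding P by (rule U.P_setI[OF U.one_in_pos_units, of _ 1]) simp
  then obtain m e where e: "e \<in> T.pos_units" "U.t = T.t powi m * e"
    unfolding T.P_set_iff using U.t_neq_0 by auto
  have eO: "e \<in> T.\<O>" using e(1) T.pos_units_subset_O by blast
  have not_tO: "1 \<noteq> T.t * y" if "y \<in> T.\<O>" for y
    using T.integral_closure_K_Int_tO[OF T.real_algebraic_in that, of 1] real_algebraic_subfield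
    by (auto simp: is_subfield_def)
  have "m = 1"
  proof -
    have "\<not> m < 1"
    proof
      assume "m < 1"
      then have "0 < 1 - m" by simp
      from T.powi_in_tO[OF this w(1)]
      obtain y where y: "y \<in> T.\<O>" "T.t powi (1 - m) * w = T.t * y" by (rule bexE)
      have "e = T.t powi (- m) * (T.t powi m * e)"
        using T.t_neq_0 by (simp add: power_int_minus)
      also have "\<dots> = T.t powi (- m) * (T.t * w)"
        using w(2) e(2) by simp
      also have "\<dots> = T.t powi (1 - m) * w"
        using power_int_add[of T.t 1 "- m"] T.t_neq_0 by simp
      finally have "e = T.t powi (1 - m) * w" .
      then have "e * inverse e = T.t * (y * inverse e)"
        using y(2) by (simp only: mult.assoc)
      then have "1 = T.t * (y * inverse e)"
        using T.pos_units_inverse(1)[OF e(1)] by simp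
      moreover have "y * inverse e \<in> T.\<O>"
        using T.pos_units_inverse(2)[OF e(1)] T.pos_units_subset_O y(1) by (auto intro: subring_mult[OF ring])
      ultimately show False using not_tO by simp
    qed
    moreover have "\<not> 1 < m"
    proof
      assume "1 < m"
      then have "0 < m - 1" by simp
      from T.powi_in_tO[OF this eO]
      obtain y where y: "y \<in> T.\<O>" "T.t powi (m - 1) * e = T.t * y" by (rule bexE)
      have "T.t * w = T.t powi m * e" using w(2) e(2) by simp
      then have "w = T.t powi (m - 1) * e"
        using T.t_neq_0 by (simp add: power_int_diff field_simps)
      then have "1 = T.t * (y * w')" using y(2) ww' by (simp add: mult.assoc[symmetric])
      then show False using not_tO[OF subring_mult[OF ring y(1) w'(1)]] by simp
    qed
    ultimately show ?thesis by simp
  qed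
  then have u: "U.t = T.t * e" using e(2) by simp
  obtain c z where c: "c \<in> \<bbbA>\<^sub>>\<^sub>0" "z \<in> T.\<O>" "inverse e = complex_of_real c + T.t * z"
    using T.pos_units_inverse(2)[OF e(1)] by (rule T.pos_unitsE)
  define b where "b = U - c * T"
  have "complex_of_real U = complex_of_real T * inverse e"
    using u by (simp flip: T.inverse_t U.inverse_t)
  also have "\<dots> = complex_of_real (c * T) + z"
    using T.t_neq_0 by (simp add: c(3) distrib_left mult.assoc[symmetric] flip: T.inverse_t)
  finally have bz: "complex_of_real b = z" by (simp add: b_def)
  have "b \<in> H_set k"
  proof (rule ccontr)
    assume "b \<notin> H_set k"
    then interpret B: point_at_infinity k b
      by unfold_locales (simp_all add: X_set_def k)
    have bT: "inverse B.t \<in> T.\<O>" using c(2) by (simp add: B.inverse_t bz)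
    then have bU: "inverse B.t \<in> U.\<O>" by (simp only: O)
    have "inverse T.t \<in> B.\<O>"
      by (rule inverse_in_integral_closure_local_ring[OF T.transcendental_element_axioms
            B.transcendental_element_axioms bT])
    moreover have "inverse U.t \<in> B.\<O>"
      by (rule inverse_in_integral_closure_local_ring[OF U.transcendental_element_axioms
            B.transcendental_element_axioms bU])
    moreover have "complex_of_real c \<in> B.\<O>"
      using c(1) by (intro B.real_algebraic_in_O) (simp add: pos_real_algebraic_iff)
    ultimately have "inverse U.t - complex_of_real c * inverse T.t \<in> B.\<O>"
      by (intro subring_diff[OF B.O_subring] subring_mult[OF B.O_subring])
    moreover have "inverse U.t - complex_of_real c * inverse T.t = inverse B.t"
      unfolding T.inverse_t U.inverse_t B.inverse_t by (simp add: b_def)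
    ultimately have "inverse B.t \<in> B.\<O>" by (simp only:)
    then show False using B.inverse_t_notin_O by simp
  qed
  then show ?thesis using c(1) by (intro bexI[of _ c] bexI[of _ b]) (simp_all add: b_def)
qed

lemma affine_coefficients_unique:
  assumes k: "is_subfield k" and T: "T \<in> X_set k"
    and a: "a \<in> H_set k" "a' \<in> H_set k" and b: "b \<in> H_set k" "b' \<in> H_set k"
    and eq: "a * T + b = a' * T + b'"
  shows "a = a' \<and> b = b'"
proof -
  note S = is_subfield_imp_subring[OF H_set_subfield[OF k]]
  have "a = a'"
  proof (rule ccontr)
    assume "a \<noteq> a'"
    then have "T = (b' - b) * inverse (a - a')" using eq by (simp add: field_simps)
    moreover have "inverse (a - a') \<in> H_set k"
      using subring_diff[OF S a] H_set_subfield[OF k] by (simp add: is_subfield_def)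
    ultimately have "T \<in> H_set k"
      using subring_diff[OF S b(2,1)] by (simp add: subring_mult[OF S])
    then show False using T by (simp add: X_set_def)
  qed
  then show ?thesis using eq by simp
qed

theorem theorem1p2:
  fixes B k :: "real set" and T U :: real
  assumes "transcendence_basis \<rat> B" and "pi \<in> B"
    and "k = field_adjoin \<rat> (B - {pi})"
    and "T \<in> X_set k" and "U \<in> X_set k"
  shows "(P_set k T = P_set k U \<longleftrightarrow> (\<exists>a\<in>\<bbbA>\<^sub>>\<^sub>0. \<exists>b\<in>H_set k. U = a * T + b)) \<and>
         (\<forall>a\<in>\<bbbA>\<^sub>>\<^sub>0. \<forall>b\<in>H_set k. \<forall>a'\<in>\<bbbA>\<^sub>>\<^sub>0. \<forall>b'\<in>H_set k.
            U = a * T + b \<and> U = a' * T + b' \<longrightarrow> a = a' \<and> b = b')"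
proof -
  have k: "is_subfield k" unfolding assms(3) by (rule is_subfield_field_adjoin)
  note H = is_subfield_imp_subring[OF H_set_subfield[OF k]]
  have AH: "a \<in> H_set k" if "a \<in> \<bbbA>\<^sub>>\<^sub>0" for a
    using that real_algebraic_subset_H_set[OF k] by (auto simp: pos_real_algebraic_iff)
  have "P_set k T = P_set k U" if a: "a \<in> \<bbbA>\<^sub>>\<^sub>0" and b: "b \<in> H_set k" and eq: "U = a * T + b" for a b
  proof
    show "P_set k U \<subseteq> P_set k T" by (rule P_set_affine_subset[OF k assms(4,5) a b eq])
    have a': "inverse a \<in> \<bbbA>\<^sub>>\<^sub>0" by (rule pos_real_algebraic_inverse[OF a])
    have b': "- (inverse a * b) \<in> H_set k"
      by (intro subring_uminus[OF H] subring_mult[OF H] AH a' b)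
    have eq': "T = inverse a * U + - (inverse a * b)"
      using a eq by (simp add: pos_real_algebraic_iff field_simps)
    show "P_set k T \<subseteq> P_set k U" by (rule P_set_affine_subset[OF k assms(5,4) a' b' eq'])
  qed
  then have iff: "P_set k T = P_set k U \<longleftrightarrow> (\<exists>a\<in>\<bbbA>\<^sub>>\<^sub>0. \<exists>b\<in>H_set k. U = a * T + b)"
    using P_set_eq_imp_affine[OF k assms(4,5)] by blast
  have "a = a' \<and> b = b'"
    if "a \<in> \<bbbA>\<^sub>>\<^sub>0" "b \<in> H_set k" "a' \<in> \<bbbA>\<^sub>>\<^sub>0" "b' \<in> H_set k" "U = a * T + b \<and> U = a' * T + b'" for a b a' b'
    using that(5) by (intro affine_coefficients_unique[OF k assms(4) AH AH] that) simp_all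
  with iff show ?thesis by simp
qed

end
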